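(* For every constant $\epsilon>0$ there exists $\alpha_0>0$ such that the following holds for every constant $0<\alpha\le\alpha_0$. Let $p=\frac{1+\epsilon}{d}$ and let $L_1$ be the largest component of $Q^d_p$. Then there exists a constant $\beta>0$ such that with high probability every subset $S\subseteq V(L_1)$ satisfying $\alpha n\le |S|\le \frac{|V(L_1)|}{2}$ has edge boundary in $Q^d_p$ satisfying $|\partial_{e,p}(S)|\ge \beta\frac{n}{d^3(\log d)^2}$.
   Context: $Q^d$ denotes the $d$-dimensional hypercube: vertex set $\{0,1\}^d$, two vertices adjacent iff they differ in exactly one coordinate; $n:=2^d$. $Q^d_p$ denotes the random subgraph of $Q^d$ on the same vertex set obtained by retaining each edge of $Q^d$ independently with probability $p$. For $S\subseteq V(Q^d)$, $\partial_{e,p}(S)$ is the set of edges of $Q^d_p$ with one endpoint in $S$ and the other in $V(Q^d)\setminus S$. "With high probability" means with probability tending to one as $d\to\infty$. *)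

theory Defs
  imports Complex_Main
begin

text \<open>Vertices of Q^d: the vector x in {0,1}^d is identified with its support,
  a subset of {0..<d}. Edges: 2-element sets {u, insert i u} with i notin u.\<close>

definition cube_vertices :: "nat \<Rightarrow> nat set set" where
  "cube_vertices d = Pow {..<d}"

definition cube_edges :: "nat \<Rightarrow> nat set set set" where
  "cube_edges d = {{u, insert i u} | u i. u \<subseteq> {..<d} \<and> i < d \<and> i \<notin> u}"

definition sub_adj :: "nat set set set \<Rightarrow> (nat set \<times> nat set) set" where
  "sub_adj F = {(u, v). {u, v} \<in> F \<and> u \<noteq> v}"

definition component :: "nat set set set \<Rightarrow> nat set \<Rightarrow> nat set set" where
  "component F v = {u. (v, u) \<in> (sub_adj F)\<^sup>*}"

definition components :: "nat \<Rightarrow> nat set set set \<Rightarrow> nat set set set" where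
  "components d F = component F ` cube_vertices d"

definition largest_component :: "nat \<Rightarrow> nat set set set \<Rightarrow> nat set set \<Rightarrow> bool" where
  "largest_component d F L \<longleftrightarrow> L \<in> components d F \<and> (\<forall>C \<in> components d F. card C \<le> card L)"

definition edge_boundary :: "nat set set set \<Rightarrow> nat set set \<Rightarrow> nat set set set" where
  "edge_boundary F S = {e \<in> F. card (e \<inter> S) = 1}"

definition cube_prob :: "nat \<Rightarrow> real \<Rightarrow> (nat set set set \<Rightarrow> bool) \<Rightarrow> real" where
  "cube_prob d p P = (\<Sum>F \<in> Pow (cube_edges d).
      if P F then p ^ card F * (1 - p) ^ (card (cube_edges d) - card F) else 0)"

end

theory Submission
  imports Defs "HOL-Library.Disjoint_Sets" "HOL-Real_Asymp.Real_Asymp"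
begin

text \<open>
  Write \<open>n = 2 ^ d\<close> and expose the random subgraph as \<open>F = F1 \<union> F2\<close>, where \<open>F1\<close> has density
  \<open>(1 + \<epsilon> - \<delta>) / d\<close> and the independent sprinkling \<open>F2\<close> has density about \<open>\<delta> / d\<close>.

  For \<open>|S|\<close> polynomial in \<open>d\<close>, the event that the component of \<open>v\<close> is \<open>S\<close> has at density
  \<open>(1 + x) / d\<close> at most \<open>\<rho> ^ |S|\<close> times its probability at the critical density \<open>1 / d\<close>,
  with \<open>\<rho> < 1\<close>: sum over spanning trees of \<open>S\<close> and use that \<open>S\<close> spans few edges of the cube.
  So components of intermediate size are rare. Hence all but a small fraction of the vertices in
  large components of \<open>F\<close> already lie in components of \<open>F1\<close> of size at least \<open>K\<close>, where \<open>K\<close> is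
  about \<open>d\<^sup>2 ln d\<close>; and all but very few vertices have linearly many neighbours in such
  components, as one sees from disjoint subcubes around these neighbours.

  A set \<open>S\<close> with fewer than \<open>m = n / (d ^ 3 (ln d)\<^sup>2)\<close> boundary edges is almost determined by its
  boundary \<open>M\<close> in \<open>F1\<close> and by the components of \<open>F1 - M\<close> of size at least \<open>K\<close> that it contains,
  which leaves \<open>exp (o (n / d\<^sup>2))\<close> possibilities. For each of them, the unions \<open>A\<close> and \<open>B\<close> of
  such components inside and outside \<open>S\<close> have linear size, and the isoperimetric inequality yields
  of order \<open>n / d\<close> disjoint gadgets, each of which joins \<open>A\<close> to \<open>B\<close> in \<open>F2\<close> with probability
  of order \<open>1 / d\<close>. Fewer than \<open>m\<close> of them do so with probability at most
  \<open>exp (- c n / d\<^sup>2)\<close>, which beats the union bound. This gives \<open>\<beta> = 1\<close> for every \<open>\<alpha>\<close>.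
\<close>

section \<open>Finite product measures\<close>

text \<open>Expectation over the random subset of \<open>E\<close> that keeps each element
  independently with probability \<open>p\<close>, with the weights of \<open>cube_prob\<close>. As
  a finite sum it makes sense for every real \<open>p\<close>, so the identities below are purely
  algebraic and only the inequalities ask for \<open>0 \<le> p\<close> and
  \<open>p \<le> 1\<close>.\<close>

definition bexp :: "'a set \<Rightarrow> real \<Rightarrow> ('a set \<Rightarrow> real) \<Rightarrow> real" where
  "bexp E p f = (\<Sum>F\<in>Pow E. p ^ card F * (1 - p) ^ (card E - card F) * f F)"

abbreviation bprob :: "'a set \<Rightarrow> real \<Rightarrow> ('a set \<Rightarrow> bool) \<Rightarrow> real" where
  "bprob E p P \<equiv> bexp E p (\<lambda>F. of_bool (P F))"

text \<open>Measurability with respect to the coordinates in \<open>A\<close>; disjoint coordinate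
  sets then yield independence.\<close>

definition depends_on :: "'a set \<Rightarrow> ('a set \<Rightarrow> 'b) \<Rightarrow> bool" where
  "depends_on A f \<longleftrightarrow> (\<forall>F. f F = f (F \<inter> A))"

lemma bexp_empty: "bexp {} p f = f {}"
  by (simp add: bexp_def)

text \<open>Conditioning on the state of the single element \<open>e\<close>. The inductions on
  expectations over the ground set unfold through this recursion.\<close>

lemma bexp_insert:
  assumes "finite E" "e \<notin> E"
  shows "bexp (insert e E) p f = p * bexp E p (\<lambda>F. f (insert e F)) + (1 - p) * bexp E p f"
proof -
  have inj: "inj_on (insert e) (Pow E)"
    using assms(2) by (auto simp: inj_on_def)
  have disj: "Pow E \<inter> insert e ` Pow E = {}"
    using assms(2) by auto
  have 1: "(\<Sum>F\<in>insert e ` Pow E. p ^ card F * (1 - p) ^ (card (insert e E) - card F) * f F)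
        = p * bexp E p (\<lambda>F. f (insert e F))"
    unfolding bexp_def sum_distrib_left sum.reindex[OF inj] comp_def
  proof (intro sum.cong refl)
    fix F assume "F \<in> Pow E"
    then have "finite F" "e \<notin> F" using assms finite_subset by auto
    then show "p ^ card (insert e F) * (1 - p) ^ (card (insert e E) - card (insert e F)) * f (insert e F)
      = p * (p ^ card F * (1 - p) ^ (card E - card F) * f (insert e F))"
      using assms by simp
  qed
  have 2: "(\<Sum>F\<in>Pow E. p ^ card F * (1 - p) ^ (card (insert e E) - card F) * f F)
        = (1 - p) * bexp E p f"
    unfolding bexp_def sum_distrib_left
  proof (intro sum.cong refl)
    fix F assume "F \<in> Pow E"
    then have "card F \<le> card E" using assms card_mono by auto
    then show "p ^ card F * (1 - p) ^ (card (insert e E) - card F) * f F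
      = (1 - p) * (p ^ card F * (1 - p) ^ (card E - card F) * f F)"
      using assms by (simp add: Suc_diff_le)
  qed
  show ?thesis
    unfolding bexp_def[of "insert e E"] Pow_insert
    by (subst sum.union_disjoint) (use assms disj 1 2 in auto)
qed

lemma bexp_cong:
  assumes "\<And>F. F \<subseteq> E \<Longrightarrow> f F = g F"
  shows "bexp E p f = bexp E p g"
  unfolding bexp_def using assms by (intro sum.cong) auto

lemma bexp_mono:
  assumes "0 \<le> p" "p \<le> 1" "\<And>F. F \<subseteq> E \<Longrightarrow> f F \<le> g F"
  shows "bexp E p f \<le> bexp E p g"
  unfolding bexp_def using assms by (intro sum_mono mult_left_mono) auto

lemma bexp_nonneg:
  assumes "0 \<le> p" "p \<le> 1" "\<And>F. F \<subseteq> E \<Longrightarrow> 0 \<le> f F"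
  shows "0 \<le> bexp E p f"
  unfolding bexp_def using assms by (intro sum_nonneg mult_nonneg_nonneg) auto

lemma bexp_add: "bexp E p (\<lambda>F. f F + g F) = bexp E p f + bexp E p g"
  unfolding bexp_def by (simp only: distrib_left sum.distrib)

lemma bexp_diff: "bexp E p (\<lambda>F. f F - g F) = bexp E p f - bexp E p g"
  unfolding bexp_def by (simp only: right_diff_distrib sum_subtractf)

lemma bexp_cmult: "bexp E p (\<lambda>F. c * f F) = c * bexp E p f"
  by (simp add: bexp_def sum_distrib_left mult_ac)

lemma bexp_sum: "bexp E p (\<lambda>F. \<Sum>i\<in>I. f i F) = (\<Sum>i\<in>I. bexp E p (f i))"
  unfolding bexp_def sum_distrib_left by (rule sum.swap)

lemma bexp_const: "finite E \<Longrightarrow> bexp E p (\<lambda>_. c) = c"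
  by (induction rule: finite_induct) (simp_all add: bexp_empty bexp_insert algebra_simps)

lemma bprob_le_1:
  assumes "finite E" "0 \<le> p" "p \<le> 1"
  shows "bprob E p P \<le> 1"
proof -
  have "bprob E p P \<le> bexp E p (\<lambda>_. 1)"
    using assms by (intro bexp_mono) auto
  then show ?thesis using bexp_const[OF assms(1)] by simp
qed

lemma bprob_not: "finite E \<Longrightarrow> bprob E p (\<lambda>F. \<not> P F) = 1 - bprob E p P"
  unfolding of_bool_not_iff by (simp only: bexp_diff bexp_const)

lemma bprob_mono:
  assumes "0 \<le> p" "p \<le> 1" "\<And>F. F \<subseteq> E \<Longrightarrow> P F \<Longrightarrow> Q F"
  shows "bprob E p P \<le> bprob E p Q"
  using assms by (intro bexp_mono) auto

lemma bprob_union_bound: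
  assumes "0 \<le> p" "p \<le> 1" "finite I" "\<And>F. F \<subseteq> E \<Longrightarrow> P F \<Longrightarrow> \<exists>i\<in>I. Q i F"
  shows "bprob E p P \<le> (\<Sum>i\<in>I. bprob E p (Q i))"
  unfolding bexp_sum[symmetric]
proof (intro bexp_mono assms(1,2))
  fix F assume F: "F \<subseteq> E"
  show "of_bool (P F) \<le> (\<Sum>i\<in>I. of_bool (Q i F) :: real)"
  proof (cases "P F")
    case True
    then obtain i where i: "i \<in> I" "Q i F" using assms(4) F by blast
    have "(of_bool (Q i F) :: real) \<le> (\<Sum>i\<in>I. of_bool (Q i F))"
      by (rule member_le_sum[OF i(1)]) (use assms in auto)
    then show ?thesis using i by simp
  qed (simp add: sum_nonneg)
qed

lemma markov_bprob:
  assumes "0 \<le> p" "p \<le> 1" "0 < t" "\<And>F. F \<subseteq> E \<Longrightarrow> 0 \<le> f F"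
  shows "bprob E p (\<lambda>F. t \<le> f F) \<le> bexp E p f / t"
proof -
  have "bprob E p (\<lambda>F. t \<le> f F) \<le> bexp E p (\<lambda>F. (1 / t) * f F)"
    using assms by (intro bexp_mono) (auto simp: field_simps)
  then show ?thesis unfolding bexp_cmult by simp
qed

text \<open>Two-round exposure: an element is missing from \<open>F1 \<union> F2\<close> exactly
  when both rounds miss it, which has probability \<open>(1 - p1) * (1 - p2)\<close>.\<close>

lemma bexp_sprinkle:
  assumes "finite E" "1 - p = (1 - p1) * (1 - p2)"
  shows "bexp E p f = bexp E p1 (\<lambda>F1. bexp E p2 (\<lambda>F2. f (F1 \<union> F2)))"
  using assms(1)
proof (induction arbitrary: f rule: finite_induct)
  case (insert e E)
  have p: "p = p1 + p2 - p1 * p2" using assms(2) by (simp add: algebra_simps)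
  let ?A = "bexp E p1 (\<lambda>F1. bexp E p2 (\<lambda>F2. f (insert e (F1 \<union> F2))))"
  let ?B = "bexp E p1 (\<lambda>F1. bexp E p2 (\<lambda>F2. f (F1 \<union> F2)))"
  have "bexp (insert e E) p1 (\<lambda>F1. bexp (insert e E) p2 (\<lambda>F2. f (F1 \<union> F2)))
    = p1 * (p2 * ?A + (1 - p2) * ?A) + (1 - p1) * (p2 * ?A + (1 - p2) * ?B)"
    using insert.hyps by (simp add: bexp_insert bexp_add bexp_cmult) algebra
  also have "\<dots> = p * ?A + (1 - p) * ?B"
    unfolding p by (simp add: algebra_simps)
  also have "\<dots> = bexp (insert e E) p f"
    using insert.hyps by (simp add: bexp_insert insert.IH)
  finally show ?case by simp
qed (simp add: bexp_empty)

section \<open>Independence over disjoint sets of edges\<close>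

lemma depends_onI: "(\<And>F. f (F \<inter> A) = f F) \<Longrightarrow> depends_on A f"
  by (simp add: depends_on_def)

lemma depends_onD: "depends_on A f \<Longrightarrow> F \<inter> A = G \<inter> A \<Longrightarrow> f F = f G"
  by (metis depends_on_def)

text \<open>Induction on \<open>E\<close>: each revealed element lies outside \<open>A\<close> or
  outside \<open>B\<close>, hence leaves one of the two factors unchanged.\<close>

lemma bexp_indep:
  assumes "finite E" "depends_on A f" "depends_on B g" "A \<inter> B = {}"
  shows "bexp E p (\<lambda>F. f F * g F) = bexp E p f * bexp E p g"
  using assms(1-3)
proof (induction arbitrary: f g rule: finite_induct)
  case (insert e E)
  have dep: "depends_on A (\<lambda>F. f (insert e F))" "depends_on B (\<lambda>F. g (insert e F))"
    by (rule depends_onI, rule depends_onD[OF insert.prems(1)], blast)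
       (rule depends_onI, rule depends_onD[OF insert.prems(2)], blast)
  have "f (insert e F) = f F" if "e \<notin> A" for F
    using that by (intro depends_onD[OF insert.prems(1)]) auto
  moreover have "g (insert e F) = g F" if "e \<notin> B" for F
    using that by (intro depends_onD[OF insert.prems(2)]) auto
  moreover have "e \<notin> A \<or> e \<notin> B" using assms(4) by auto
  ultimately show ?case
    using insert.hyps insert.IH[OF insert.prems] insert.IH[OF dep]
    by (auto simp: bexp_insert algebra_simps)
qed (simp add: bexp_empty)

lemma bexp_indep_prod:
  assumes "finite E" "finite I" "disjoint_family_on A I" "\<And>i. i \<in> I \<Longrightarrow> depends_on (A i) (f i)"
  shows "bexp E p (\<lambda>F. \<Prod>i\<in>I. f i F) = (\<Prod>i\<in>I. bexp E p (f i))"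
  using assms(2-4)
proof (induction rule: finite_induct)
  case empty
  then show ?case using assms(1) by (simp add: bexp_const)
next
  case (insert i I)
  have "depends_on (\<Union>j\<in>I. A j) (\<lambda>F. \<Prod>j\<in>I. f j F)"
  proof (intro depends_onI prod.cong refl)
    fix F j assume j: "j \<in> I"
    show "f j (F \<inter> (\<Union>j\<in>I. A j)) = f j F"
      by (rule depends_onD[OF insert.prems(2)[of j]]) (use j in auto)
  qed
  moreover have "A i \<inter> (\<Union>j\<in>I. A j) = {}"
    using insert.prems(1) insert.hyps(2) by (fastforce simp: disjoint_family_on_def)
  moreover have "disjoint_family_on A I"
    using insert.prems(1) by (auto simp: disjoint_family_on_def)
  ultimately show ?case
    using bexp_indep[OF assms(1), of "A i" "f i" "\<Union>j\<in>I. A j" "\<lambda>F. \<Prod>j\<in>I. f j F"]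
      insert.hyps insert.prems(2) insert.IH by simp
qed

lemma bprob_mem: "finite E \<Longrightarrow> e \<in> E \<Longrightarrow> bprob E p (\<lambda>F. e \<in> F) = p"
proof -
  assume E: "finite E" "e \<in> E"
  then have *: "E = insert e (E - {e})" by auto
  have "bexp (E - {e}) p (\<lambda>F. of_bool (e \<in> F)) = bexp (E - {e}) p (\<lambda>_. 0)"
    by (intro bexp_cong) auto
  then show ?thesis
    by (subst *, subst bexp_insert) (use E in \<open>auto simp: bexp_const\<close>)
qed

lemma bprob_cylinder:
  assumes "finite E" "T \<subseteq> E" "Z \<subseteq> E" "T \<inter> Z = {}"
  shows "bprob E p (\<lambda>F. T \<subseteq> F \<and> F \<inter> Z = {}) = p ^ card T * (1 - p) ^ card Z"
proof -
  have fin: "finite T" "finite Z" using assms by (auto intro: finite_subset)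
  let ?g = "\<lambda>e F. of_bool (if e \<in> T then e \<in> F else e \<notin> F) :: real"
  have "bprob E p (\<lambda>F. T \<subseteq> F \<and> F \<inter> Z = {}) = bexp E p (\<lambda>F. \<Prod>e\<in>T \<union> Z. ?g e F)"
  proof (intro bexp_cong)
    fix F
    show "of_bool (T \<subseteq> F \<and> F \<inter> Z = {}) = (\<Prod>e\<in>T \<union> Z. ?g e F)"
    proof (cases "T \<subseteq> F \<and> F \<inter> Z = {}")
      case True
      then have "(\<Prod>e\<in>T \<union> Z. ?g e F) = 1" by (intro prod.neutral) auto
      then show ?thesis using True by (simp only: of_bool_eq simp_thms)
    next
      case False
      then obtain e where "e \<in> T \<and> e \<notin> F \<or> e \<in> Z \<and> e \<in> F" by auto
      then have "e \<in> T \<union> Z" "?g e F = 0" using assms(4) by auto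
      then have "(\<Prod>e\<in>T \<union> Z. ?g e F) = 0" using fin by (intro prod_zero) blast+
      then show ?thesis using False by (simp only: of_bool_eq simp_thms)
    qed
  qed
  also have "\<dots> = (\<Prod>e\<in>T \<union> Z. bexp E p (?g e))"
    using fin assms
    by (intro bexp_indep_prod[where A = "\<lambda>e. {e}"])
       (auto simp: disjoint_family_on_def intro!: depends_onI)
  also have "\<dots> = (\<Prod>e\<in>T. bexp E p (?g e)) * (\<Prod>e\<in>Z. bexp E p (?g e))"
    using fin assms by (intro prod.union_disjoint) auto
  also have "(\<Prod>e\<in>T. bexp E p (?g e)) = (\<Prod>e\<in>T. p)"
    using assms by (intro prod.cong) (auto simp: bprob_mem)
  also have "(\<Prod>e\<in>Z. bexp E p (?g e)) = (\<Prod>e\<in>Z. 1 - p)"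
  proof (intro prod.cong refl)
    fix e assume "e \<in> Z"
    then have "e \<notin> T" "e \<in> E" using assms by auto
    then show "bexp E p (?g e) = 1 - p"
      using bprob_not[OF assms(1), of p "\<lambda>F. e \<in> F"] by (simp add: bprob_mem assms(1))
  qed
  finally show ?thesis by simp
qed

lemma bprob_meets:
  assumes "finite E" "Z \<subseteq> E"
  shows "bprob E p (\<lambda>F. F \<inter> Z \<noteq> {}) = 1 - (1 - p) ^ card Z"
  using bprob_not[OF assms(1), of p "\<lambda>F. F \<inter> Z = {}"] bprob_cylinder[OF assms(1) _ assms(2), of "{}" p]
  by simp

section \<open>Tail and counting estimates for the union bound\<close>

text \<open>Exponential moments: on the event, exp of \<open>k\<close> minus the count is at least
  1. Each event contributes an independent factor, \<open>exp (-1)\<close> if it occurs and 1 if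
  not, of mean at most \<open>1 - r / 2 \<le> exp (- r / 2)\<close>, because
  \<open>exp (-1) \<le> 1 / 2\<close>.\<close>

lemma chernoff_lower:
  assumes "finite E" "0 \<le> p" "p \<le> 1" "finite I" "disjoint_family_on A I"
    and dep: "\<And>i. i \<in> I \<Longrightarrow> depends_on (A i) (Q i)"
    and r: "\<And>i. i \<in> I \<Longrightarrow> r \<le> bprob E p (Q i)" "0 \<le> r"
  shows "bprob E p (\<lambda>F. real (card {i \<in> I. Q i F}) \<le> k) \<le> exp (k - r * card I / 2)"
proof -
  let ?f = "\<lambda>i F. if Q i F then exp (-1) else 1 :: real"
  have prodf: "(\<Prod>i\<in>I. ?f i F) = exp (- real (card {i \<in> I. Q i F}))" for F
  proof -
    have "(\<Prod>i\<in>I. ?f i F) = exp (-1) ^ card {i \<in> I. Q i F}"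
      using assms(4) by (simp add: prod.If_cases Int_def)
    then show ?thesis by (simp flip: exp_of_nat_mult)
  qed
  have "bprob E p (\<lambda>F. real (card {i \<in> I. Q i F}) \<le> k) \<le> bexp E p (\<lambda>F. exp k * (\<Prod>i\<in>I. ?f i F))"
    unfolding prodf by (intro bexp_mono assms) (auto simp flip: exp_add)
  also have "\<dots> = exp k * (\<Prod>i\<in>I. bexp E p (?f i))"
    unfolding bexp_cmult
  proof (subst bexp_indep_prod[OF assms(1,4,5)])
    fix i assume "i \<in> I"
    then have "Q i (F \<inter> A i) = Q i F" for F
      by (intro depends_onD[OF dep]) auto
    then show "depends_on (A i) (?f i)" by (intro depends_onI) simp
  qed simp
  also have "\<dots> \<le> exp k * (\<Prod>i\<in>I. exp (- r / 2))"
  proof (intro mult_left_mono prod_mono conjI)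
    fix i assume i: "i \<in> I"
    show "0 \<le> bexp E p (?f i)" by (intro bexp_nonneg assms) auto
    have "exp (-1::real) \<le> 1 / 2"
      using exp_ge_add_one_self[of "1::real"] by (simp add: exp_minus field_simps)
    then have "bexp E p (?f i) \<le> bexp E p (\<lambda>F. 1 - 1 / 2 * of_bool (Q i F))"
      by (intro bexp_mono assms) auto
    also have "\<dots> = 1 - bprob E p (Q i) / 2"
      using assms(1) by (simp only: bexp_diff bexp_const bexp_cmult)
    also have "\<dots> \<le> 1 - r / 2" using r(1)[OF i] by simp
    also have "\<dots> \<le> exp (- r / 2)" using exp_ge_add_one_self[of "- r / 2"] by simp
    finally show "bexp E p (?f i) \<le> exp (- r / 2)" .
  qed simp
  also have "\<dots> = exp (k - r * card I / 2)"
    unfolding prod_constant exp_of_nat_mult[symmetric] exp_add[symmetric] by (simp add: mult.commute)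
  finally show ?thesis .
qed

text \<open>Give each subset \<open>M\<close> the weight \<open>x ^ card M\<close>. Every counted
  set weighs at least \<open>x\<close> to the power \<open>m\<close>, and the total weight is
  \<open>(1 + x) ^ card E\<close>. The free parameter \<open>x\<close> is later taken to be an
  inverse power of \<open>d\<close>.\<close>

lemma card_small_subsets_le:
  fixes m x :: real
  assumes "finite E" "0 < x" "x \<le> 1"
  shows "real (card {M. M \<subseteq> E \<and> real (card M) \<le> m}) \<le> exp (x * card E - m * ln x)"
proof -
  have sum: "(\<Sum>M\<in>Pow E. x ^ card M) = (1 + x) ^ card E"
    using assms(1)
  proof (induction rule: finite_induct)
    case (insert e E)
    have inj: "inj_on (insert e) (Pow E)"
      using insert.hyps by (auto simp: inj_on_def)
    have "(\<Sum>M\<in>insert e ` Pow E. x ^ card M) = (\<Sum>M\<in>Pow E. x * x ^ card M)"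
      unfolding sum.reindex[OF inj] comp_def
    proof (intro sum.cong refl)
      fix M assume "M \<in> Pow E"
      then have "finite M" "e \<notin> M" using insert.hyps finite_subset by auto
      then show "x ^ card (insert e M) = x * x ^ card M" by simp
    qed
    then show ?case
      unfolding Pow_insert
      by (subst sum.union_disjoint)
         (use insert in \<open>auto simp: algebra_simps simp flip: sum_distrib_left\<close>)
  qed simp
  have "exp (m * ln x) * card {M. M \<subseteq> E \<and> real (card M) \<le> m}
      = (\<Sum>M\<in>{M. M \<subseteq> E \<and> real (card M) \<le> m}. exp (m * ln x))"
    by simp
  also have "\<dots> \<le> (\<Sum>M\<in>{M. M \<subseteq> E \<and> real (card M) \<le> m}. x ^ card M)"
  proof (intro sum_mono)
    fix M assume "M \<in> {M. M \<subseteq> E \<and> real (card M) \<le> m}"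
    then have "m * ln x \<le> card M * ln x"
      using assms by (intro mult_right_mono_neg) auto
    then have "exp (m * ln x) \<le> exp (card M * ln x)" by simp
    also have "\<dots> = x ^ card M" using assms by (simp add: exp_of_nat_mult)
    finally show "exp (m * ln x) \<le> x ^ card M" .
  qed
  also have "\<dots> \<le> (\<Sum>M\<in>Pow E. x ^ card M)"
    using assms by (intro sum_mono2) auto
  also have "\<dots> \<le> exp x ^ card E"
    unfolding sum using assms exp_ge_add_one_self[of x] by (intro power_mono) auto
  also have "\<dots> = exp (x * card E)"
    by (simp flip: exp_of_nat_mult add: mult.commute)
  finally show ?thesis
    by (simp add: exp_diff field_simps)
qed

section \<open>The hypercube and its isoperimetry\<close>

text \<open>The neighbour of \<open>x\<close> in direction \<open>i\<close>. Since this is an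
  involution, an edge has the same description from either endpoint.\<close>

definition flip :: "nat \<Rightarrow> nat set \<Rightarrow> nat set" where
  "flip i x = (if i \<in> x then x - {i} else insert i x)"

lemma flip_flip [simp]: "flip i (flip i x) = x"
  by (auto simp: flip_def)

lemma flip_neq [simp]: "flip i x \<noteq> x" "x \<noteq> flip i x"
  by (auto simp: flip_def)

lemma flip_eq_iff [simp]: "flip i x = flip j x \<longleftrightarrow> i = j"
  by (auto simp: flip_def split: if_splits)

lemma mem_flip_iff: "j \<in> flip i x \<longleftrightarrow> (j \<in> x \<longleftrightarrow> j \<noteq> i)"
  by (auto simp: flip_def)

lemma flip_in_cube [simp]: "i < d \<Longrightarrow> flip i x \<in> cube_vertices d \<longleftrightarrow> x \<in> cube_vertices d"
  by (auto simp: flip_def cube_vertices_def)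

lemma finite_cube_vertices [simp]: "finite (cube_vertices d)"
  by (simp add: cube_vertices_def)

lemma card_cube_vertices: "card (cube_vertices d) = 2 ^ d"
  by (simp add: cube_vertices_def card_Pow)

lemma cube_edges_eq: "cube_edges d = (\<lambda>(x, i). {x, flip i x}) ` (cube_vertices d \<times> {..<d})"
proof (intro equalityI subsetI)
  fix e assume "e \<in> cube_edges d"
  then obtain u i where "e = {u, insert i u}" "u \<subseteq> {..<d}" "i < d" "i \<notin> u"
    by (auto simp: cube_edges_def)
  then show "e \<in> (\<lambda>(x, i). {x, flip i x}) ` (cube_vertices d \<times> {..<d})"
    by (intro image_eqI[of _ _ "(u, i)"]) (auto simp: flip_def cube_vertices_def)
next
  fix e assume "e \<in> (\<lambda>(x, i). {x, flip i x}) ` (cube_vertices d \<times> {..<d})"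
  then obtain x i where e: "e = {x, flip i x}" "x \<subseteq> {..<d}" "i < d"
    by (auto simp: cube_vertices_def)
  define u where "u = x - {i}"
  have "e = {u, insert i u}"
    using e(1) by (auto simp: u_def flip_def insert_absorb insert_commute)
  moreover have "u \<subseteq> {..<d}" "i \<notin> u" using e(2) by (auto simp: u_def)
  ultimately show "e \<in> cube_edges d" using e(3) by (auto simp: cube_edges_def)
qed

lemma flip_edge [simp]: "x \<in> cube_vertices d \<Longrightarrow> i < d \<Longrightarrow> {x, flip i x} \<in> cube_edges d"
  unfolding cube_edges_eq by (intro image_eqI[of _ _ "(x, i)"]) auto

lemma cube_edge_cases:
  assumes "e \<in> cube_edges d"
  obtains x i where "e = {x, flip i x}" "x \<in> cube_vertices d" "i < d"
proof -
  obtain z where z: "z \<in> cube_vertices d \<times> {..<d}" "e = (\<lambda>(x, i). {x, flip i x}) z"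
    using assms unfolding cube_edges_eq by (rule imageE)
  obtain x i where "z = (x, i)" by (rule prod.exhaust)
  then show thesis using z by (intro that[of x i]) simp_all
qed

lemma cube_edgeE:
  assumes "e \<in> cube_edges d" "x \<in> e"
  obtains i where "i < d" "e = {x, flip i x}" "x \<in> cube_vertices d"
proof -
  obtain y i where y: "e = {y, flip i y}" "y \<in> cube_vertices d" "i < d"
    using assms(1) by (rule cube_edge_cases)
  from y(1) consider "x = y" | "x = flip i y" using assms(2) by blast
  then show thesis
  proof cases
    case 1
    then show thesis using y by (intro that[of i]) simp_all
  next
    case 2
    then have "e = {x, flip i x}" unfolding y(1) by (simp only: flip_flip insert_commute)
    then show thesis using y 2 by (intro that[of i]) simp_all
  qed
qed

lemma finite_cube_edges [simp]: "finite (cube_edges d)"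
  by (simp add: cube_edges_eq)

lemma card_cube_edges_le: "card (cube_edges d) \<le> 2 ^ d * d"
proof -
  have "card (cube_edges d) \<le> card (cube_vertices d \<times> {..<d})"
    unfolding cube_edges_eq by (intro card_image_le) auto
  then show ?thesis by (simp add: card_cartesian_product card_cube_vertices)
qed

section \<open>Edge-isoperimetry of the cube\<close>

text \<open>The function \<open>(a + t) * ln (a + t) - t * ln t\<close> is nondecreasing in
  \<open>t\<close>; comparing its values at \<open>t = a\<close> and \<open>t = b\<close> gives the
  claim.\<close>

lemma mult_log_add_ge:
  fixes a b :: real
  assumes "0 < a" "a \<le> b"
  shows "a * log 2 a + b * log 2 b + 2 * a \<le> (a + b) * log 2 (a + b)"
proof -
  let ?f = "\<lambda>t. (a + t) * ln (a + t) - t * ln t"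
  have "?f a \<le> ?f b"
  proof (rule DERIV_nonneg_imp_nondecreasing[OF assms(2)])
    fix t assume t: "a \<le> t" "t \<le> b"
    then have "0 < t" using assms by simp
    then have "(?f has_real_derivative (ln (a + t) + 1 - (ln t + 1))) (at t)"
      using assms by (auto intro!: derivative_eq_intros)
    moreover have "ln t \<le> ln (a + t)" using \<open>0 < t\<close> assms by simp
    ultimately show "\<exists>y. (?f has_real_derivative y) (at t) \<and> 0 \<le> y" by force
  qed
  moreover have "ln (a + a) = ln 2 + ln a"
    using assms(1) ln_mult[of 2 a] by simp
  ultimately have "a * ln a + b * ln b + 2 * a * ln 2 \<le> (a + b) * ln (a + b)"
    by (simp add: algebra_simps)
  then have "(a * ln a + b * ln b + 2 * a * ln 2) / ln 2 \<le> (a + b) * ln (a + b) / ln 2"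
    by (intro divide_right_mono) auto
  then show ?thesis by (simp add: log_def add_divide_distrib)
qed

text \<open>Entropy form of the edge-isoperimetric inequality, by induction on the dimension.
  Cutting along the last coordinate splits \<open>S\<close> into halves \<open>S0\<close> and
  \<open>S1\<close>. The edges between them, counted from both ends, add at most twice the size of
  the smaller half, which is the gain in \<open>mult_log_add_ge\<close>.\<close>

lemma sum_inner_degree_le:
  assumes "S \<subseteq> cube_vertices d"
  shows "real (\<Sum>x\<in>S. card {i. i < d \<and> flip i x \<in> S}) \<le> card S * log 2 (card S)"
  using assms
proof (induction d arbitrary: S)
  case 0
  then show ?case by (cases "card S = 0") simp_all
next
  case (Suc d)
  define S0 where "S0 = {x \<in> cube_vertices d. x \<in> S}"
  define S1 where "S1 = {x \<in> cube_vertices d. insert d x \<in> S}"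
  have sub: "S0 \<subseteq> cube_vertices d" "S1 \<subseteq> cube_vertices d" by (auto simp: S0_def S1_def)
  then have fin: "finite S0" "finite S1" using finite_subset finite_cube_vertices by blast+
  have d_notin: "d \<notin> x" if "x \<in> cube_vertices d" for x using that by (auto simp: cube_vertices_def)
  have inj: "inj_on (insert d) S1"
    using d_notin sub(2) by (intro inj_onI) (metis insert_ident subsetD)
  have S: "S = S0 \<union> insert d ` S1"
  proof (intro equalityI subsetI)
    fix x assume x: "x \<in> S"
    then have x': "x \<subseteq> {..<Suc d}" using Suc.prems by (auto simp: cube_vertices_def)
    show "x \<in> S0 \<union> insert d ` S1"
    proof (cases "d \<in> x")
      case True
      have "x - {d} \<in> cube_vertices d" using x' by (auto simp: cube_vertices_def less_Suc_eq)
      then have "x - {d} \<in> S1" using x True by (simp add: S1_def insert_absorb)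
      then show ?thesis using True by (metis UnI2 image_eqI insert_Diff)
    next
      case False
      then show ?thesis using x x' by (auto simp: S0_def cube_vertices_def less_Suc_eq)
    qed
  qed (auto simp: S0_def S1_def)
  have disj: "S0 \<inter> insert d ` S1 = {}" using d_notin sub(1) by auto
  have cardS: "card S = card S0 + card S1"
    unfolding S using fin disj by (simp add: card_Un_disjoint card_image[OF inj])
  \<comment> \<open>The extra term is the edge in the new direction \<open>d\<close>, present when
    the same vertex of the smaller cube lies in both halves.\<close>
  have deg0: "card {i. i < Suc d \<and> flip i x \<in> S} = card {i. i < d \<and> flip i x \<in> S0} + of_bool (x \<in> S1)"
    if "x \<in> S0" for x
  proof -
    have x: "x \<in> cube_vertices d" using that sub by auto
    have "{i. i < Suc d \<and> flip i x \<in> S}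
      = {i. i < d \<and> flip i x \<in> S0} \<union> (if x \<in> S1 then {d} else {})"
      using x d_notin[OF x] by (auto simp: less_Suc_eq S0_def S1_def flip_def[of d])
    then show ?thesis by (simp add: card_insert_if)
  qed
  have deg1: "card {i. i < Suc d \<and> flip i (insert d x) \<in> S}
      = card {i. i < d \<and> flip i x \<in> S1} + of_bool (x \<in> S0)" if "x \<in> S1" for x
  proof -
    have x: "x \<in> cube_vertices d" using that sub by auto
    have "flip i (insert d x) = insert d (flip i x)" if "i < d" for i
      using that by (auto simp: flip_def)
    then have "{i. i < Suc d \<and> flip i (insert d x) \<in> S}
      = {i. i < d \<and> flip i x \<in> S1} \<union> (if x \<in> S0 then {d} else {})"
      using x d_notin[OF x] by (auto simp: less_Suc_eq S0_def S1_def flip_def[of d])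
    then show ?thesis by (simp add: card_insert_if)
  qed
  have "(\<Sum>x\<in>S. card {i. i < Suc d \<and> flip i x \<in> S})
      = (\<Sum>x\<in>S0. card {i. i < Suc d \<and> flip i x \<in> S})
      + (\<Sum>x\<in>S1. card {i. i < Suc d \<and> flip i (insert d x) \<in> S})"
    by (subst (1) S, subst sum.union_disjoint) (use fin disj in \<open>auto simp: sum.reindex[OF inj]\<close>)
  also have "\<dots> = (\<Sum>x\<in>S0. card {i. i < d \<and> flip i x \<in> S0}) + card (S0 \<inter> S1)
      + ((\<Sum>x\<in>S1. card {i. i < d \<and> flip i x \<in> S1}) + card (S1 \<inter> S0))"
    using fin by (simp add: deg0 deg1 sum.distrib)
  finally have "real (\<Sum>x\<in>S. card {i. i < Suc d \<and> flip i x \<in> S})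
      \<le> card S0 * log 2 (card S0) + card S1 * log 2 (card S1) + 2 * card (S0 \<inter> S1)"
    using Suc.IH[OF sub(1)] Suc.IH[OF sub(2)] by (simp add: Int_commute)
  also have "\<dots> \<le> card S * log 2 (card S)"
  proof (cases "card S0 = 0 \<or> card S1 = 0")
    case True
    then show ?thesis using fin cardS by auto
  next
    case False
    have le: "card (S0 \<inter> S1) \<le> card S0" "card (S0 \<inter> S1) \<le> card S1"
      using fin by (auto intro: card_mono)
    show ?thesis
    proof (cases "card S0 \<le> card S1")
      case True
      then show ?thesis
        using mult_log_add_ge[of "card S0" "card S1"] False le by (simp add: cardS)
    next
      case F: False
      then show ?thesis
        using mult_log_add_ge[of "card S1" "card S0"] False le by (simp add: cardS add.commute)
    qed
  qed
  finally show ?case .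
qed

text \<open>The edge boundary of \<open>X\<close> in the full cube, each edge recorded once by its
  endpoint in \<open>X\<close> and its direction.\<close>

definition out_pairs :: "nat \<Rightarrow> nat set set \<Rightarrow> (nat set \<times> nat) set" where
  "out_pairs d X = {(x, i). x \<in> X \<and> i < d \<and> flip i x \<notin> X}"

lemma card_out_pairs:
  assumes "finite X"
  shows "card (out_pairs d X) = (\<Sum>x\<in>X. card {i. i < d \<and> flip i x \<notin> X})"
proof -
  have "out_pairs d X = (SIGMA x:X. {i. i < d \<and> flip i x \<notin> X})"
    by (auto simp: out_pairs_def)
  then show ?thesis using assms by (simp add: card_SigmaI)
qed

lemma card_out_pairs_ge_log:
  assumes "X \<subseteq> cube_vertices d"
  shows "card X * (d - log 2 (card X)) \<le> card (out_pairs d X)"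
proof -
  have fin: "finite X" by (rule finite_subset[OF assms]) simp
  have "card {i. i < d \<and> flip i x \<notin> X} + card {i. i < d \<and> flip i x \<in> X} = d" for x
  proof -
    have "card {i. i < d \<and> flip i x \<notin> X} + card {i. i < d \<and> flip i x \<in> X}
      = card ({i. i < d \<and> flip i x \<notin> X} \<union> {i. i < d \<and> flip i x \<in> X})"
      by (subst card_Un_disjoint) auto
    also have "{i. i < d \<and> flip i x \<notin> X} \<union> {i. i < d \<and> flip i x \<in> X} = {..<d}" by auto
    finally show ?thesis by simp
  qed
  then have "card (out_pairs d X) + (\<Sum>x\<in>X. card {i. i < d \<and> flip i x \<in> X}) = card X * d"
    unfolding card_out_pairs[OF fin] sum.distrib[symmetric] by simp
  then have "real (card (out_pairs d X)) + real (\<Sum>x\<in>X. card {i. i < d \<and> flip i x \<in> X}) = card X * d"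
    by (simp only: of_nat_add[symmetric] of_nat_mult[symmetric])
  then show ?thesis using sum_inner_degree_le[OF assms] by (simp add: algebra_simps)
qed

text \<open>For sets of at most half the cube the logarithmic bound leaves at least one outgoing
  direction per vertex on average. A larger set has the same boundary as its complement, via
  \<open>(x, i) \<mapsto> (flip i x, i)\<close>.\<close>

lemma card_out_pairs_ge_min:
  assumes "X \<subseteq> cube_vertices d"
  shows "min (card X) (2 ^ d - card X) \<le> card (out_pairs d X)"
proof -
  have half: "card Y \<le> card (out_pairs d Y)" if "Y \<subseteq> cube_vertices d" "2 * card Y \<le> 2 ^ d" for Y
  proof (cases "card Y = 0")
    case False
    have "real (2 * card Y) \<le> real (2 ^ d)" using that(2) by (simp only: of_nat_le_iff)
    then have "log 2 (2 * card Y) \<le> log 2 (2 ^ d)"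
      using False by (subst log_le_cancel_iff) simp_all
    then have "1 + log 2 (card Y) \<le> d" using False by (simp add: log_mult log_nat_power)
    then have "real (card Y) * 1 \<le> card Y * (d - log 2 (card Y))" by (intro mult_left_mono) auto
    then show ?thesis using card_out_pairs_ge_log[OF that(1)] by linarith
  qed simp
  show ?thesis
  proof (cases "2 * card X \<le> 2 ^ d")
    case True
    then show ?thesis using half[OF assms] by simp
  next
    case False
    let ?Y = "cube_vertices d - X"
    have Y: "card ?Y = 2 ^ d - card X"
      using assms by (simp add: card_Diff_subset finite_subset card_cube_vertices)
    have "bij_betw (\<lambda>(x, i). (flip i x, i)) (out_pairs d ?Y) (out_pairs d X)"
      by (rule bij_betwI[where g = "\<lambda>(x, i). (flip i x, i)"])
         (use assms in \<open>auto simp: out_pairs_def\<close>)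
    then have "card (out_pairs d ?Y) = card (out_pairs d X)" by (rule bij_betw_same_card)
    moreover have "card ?Y \<le> card (out_pairs d ?Y)"
      using False Y by (intro half) auto
    ultimately show ?thesis using Y by simp
  qed
qed

section \<open>Components and the change of measure\<close>

lemma component_refl [simp]: "v \<in> component F v"
  by (simp add: component_def)

lemma component_mono: "F \<subseteq> G \<Longrightarrow> component F v \<subseteq> component G v"
  unfolding component_def by (auto simp: sub_adj_def intro: rtrancl_mono[THEN subsetD, rotated])

lemma component_step: "u \<in> component F v \<Longrightarrow> {u, w} \<in> F \<Longrightarrow> w \<in> component F v"
  unfolding component_def sub_adj_def
  by (cases "u = w") (auto intro: rtrancl_into_rtrancl)

lemma component_subset:
  assumes "v \<in> S" "\<And>u w. u \<in> S \<Longrightarrow> {u, w} \<in> F \<Longrightarrow> w \<in> S"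
  shows "component F v \<subseteq> S"
proof
  fix u assume "u \<in> component F v"
  then have "(v, u) \<in> (sub_adj F)\<^sup>*" by (simp add: component_def)
  then show "u \<in> S"
    by (induction rule: rtrancl_induct) (use assms in \<open>auto simp: sub_adj_def\<close>)
qed

lemma component_least:
  assumes "v \<in> S" "edge_boundary F S = {}"
  shows "component F v \<subseteq> S"
proof (rule component_subset[OF assms(1)], rule ccontr)
  fix u w assume uw: "u \<in> S" "{u, w} \<in> F" "w \<notin> S"
  then have "{u, w} \<inter> S = {u}" by blast
  then have "{u, w} \<in> edge_boundary F S" using uw by (simp add: edge_boundary_def)
  then show False using assms(2) by simp
qed

lemma component_sym: "u \<in> component F v \<longleftrightarrow> v \<in> component F u"
proof -
  have "sym (sub_adj F)" by (auto simp: sym_def sub_adj_def insert_commute)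
  then have "sym ((sub_adj F)\<^sup>*)" by (rule sym_rtrancl)
  then show ?thesis by (auto simp: component_def dest: symD)
qed

lemma component_eqI:
  assumes "u \<in> component F v"
  shows "component F u = component F v"
proof -
  have "v \<in> component F u" using assms component_sym by blast
  then show ?thesis using assms by (auto simp: component_def intro: rtrancl_trans)
qed

lemma edge_boundary_iff:
  assumes "F \<subseteq> cube_edges d"
  shows "e \<in> edge_boundary F S \<longleftrightarrow> e \<in> F \<and> (\<exists>x i. x \<in> S \<and> flip i x \<notin> S \<and> i < d \<and> e = {x, flip i x})"
proof
  assume "e \<in> edge_boundary F S"
  then have e: "e \<in> F" "card (e \<inter> S) = 1" by (auto simp: edge_boundary_def)
  obtain x where x: "e \<inter> S = {x}" using e(2) by (rule card_1_singletonE)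
  then have "x \<in> e" by blast
  then obtain i where i: "i < d" "e = {x, flip i x}"
    using e(1) assms by (meson cube_edgeE subsetD)
  have "x \<in> S" "flip i x \<notin> S"
    using x unfolding i(2) by (blast, metis Int_iff flip_neq(1) insertCI singletonD)
  then show "e \<in> F \<and> (\<exists>x i. x \<in> S \<and> flip i x \<notin> S \<and> i < d \<and> e = {x, flip i x})"
    using e i by blast
next
  assume "e \<in> F \<and> (\<exists>x i. x \<in> S \<and> flip i x \<notin> S \<and> i < d \<and> e = {x, flip i x})"
  then obtain x i where e: "e \<in> F" "x \<in> S" "flip i x \<notin> S" "e = {x, flip i x}" by blast
  then have "e \<inter> S = {x}" by blast
  then show "e \<in> edge_boundary F S" using e by (simp add: edge_boundary_def)
qed

lemma edge_boundary_component:
  assumes "F \<subseteq> cube_edges d"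
  shows "edge_boundary F (component F v) = {}"
proof (rule ccontr)
  assume "edge_boundary F (component F v) \<noteq> {}"
  then obtain e where "e \<in> edge_boundary F (component F v)" by blast
  then obtain x i where "{x, flip i x} \<in> F" "x \<in> component F v" "flip i x \<notin> component F v"
    unfolding edge_boundary_iff[OF assms] by blast
  then show False using component_step by metis
qed

section \<open>Spanning trees and the comparison of two densities\<close>

text \<open>A breadth-first tree: every vertex other than \<open>v\<close> picks a neighbour
  strictly closer to \<open>v\<close>, giving at most one edge per vertex other than
  \<open>v\<close>.\<close>

lemma component_spanning_tree:
  assumes "finite (component F v)"
  obtains T where "T \<subseteq> F" "\<And>e. e \<in> T \<Longrightarrow> e \<subseteq> component F v"
    "card T < card (component F v)" "component T v = component F v"
proof -
  let ?S = "component F v" and ?R = "sub_adj F"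
  define dist where "dist u = (LEAST n. (v, u) \<in> ?R ^^ n)" for u
  have "\<exists>w\<in>?S. {w, u} \<in> F \<and> dist w < dist u" if u: "u \<in> ?S - {v}" for u
  proof -
    have "\<exists>n. (v, u) \<in> ?R ^^ n"
      using u by (simp add: component_def rtrancl_power)
    then have d: "(v, u) \<in> ?R ^^ dist u"
      unfolding dist_def by (rule LeastI_ex)
    have "dist u \<noteq> 0"
    proof
      assume "dist u = 0"
      then show False using d u by simp
    qed
    then obtain m where m: "dist u = Suc m" using not0_implies_Suc by blast
    obtain w where w: "(v, w) \<in> ?R ^^ m" "(w, u) \<in> ?R"
      using d unfolding m by (rule relpow_Suc_E)
    have "dist w \<le> m" unfolding dist_def using w(1) by (rule Least_le)
    then have "dist w < dist u" using m by simp
    moreover have "w \<in> ?S" unfolding component_def rtrancl_power using w(1) by blast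
    moreover have "{w, u} \<in> F" using w(2) by (simp add: sub_adj_def)
    ultimately show ?thesis by blast
  qed
  then have "\<forall>u\<in>?S - {v}. \<exists>w. w \<in> ?S \<and> {w, u} \<in> F \<and> dist w < dist u" by blast
  from bchoice[OF this] obtain par
    where par: "\<forall>u\<in>?S - {v}. par u \<in> ?S \<and> {par u, u} \<in> F \<and> dist (par u) < dist u" ..
  define T where "T = (\<lambda>u. {par u, u}) ` (?S - {v})"
  have "T \<subseteq> F" unfolding T_def using par by blast
  moreover have "e \<subseteq> ?S" if "e \<in> T" for e using that par unfolding T_def by blast
  moreover have "card T < card ?S"
  proof -
    have "card T \<le> card (?S - {v})" unfolding T_def using assms by (intro card_image_le) auto
    also have "\<dots> < card ?S" by (rule card_Diff1_less[OF assms component_refl])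
    finally show ?thesis .
  qed
  moreover have "component T v = ?S"
  proof
    show "component T v \<subseteq> ?S" by (rule component_mono) fact
    show "?S \<subseteq> component T v"
    proof
      fix u assume "u \<in> ?S"
      then show "u \<in> component T v"
      proof (induction "dist u" arbitrary: u rule: less_induct)
        case less
        show ?case
        proof (cases "u = v")
          case False
          then have "par u \<in> component T v" using less.hyps[of "par u"] less.prems par by blast
          moreover have "{par u, u} \<in> T"
            unfolding T_def using less.prems False by (intro imageI) simp
          ultimately show ?thesis by (rule component_step)
        qed simp
      qed
    qed
  qed
  ultimately show thesis by (rule that)
qed

lemma sum_inner_degree_le_nat:
  assumes "S \<subseteq> cube_vertices d" "card S \<le> 2 ^ l"
  shows "(\<Sum>x\<in>S. card {i. i < d \<and> flip i x \<in> S}) \<le> card S * l"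
proof (cases "card S = 0")
  case True
  then have "S = {}" using assms(1) finite_subset[OF _ finite_cube_vertices] by auto
  then show ?thesis by simp
next
  case False
  have "real (card S) \<le> real (2 ^ l)" using assms(2) by (simp only: of_nat_le_iff)
  then have "log 2 (card S) \<le> log 2 (2 ^ l)"
    using False by (subst log_le_cancel_iff) simp_all
  then have "log 2 (card S) \<le> l" by (simp add: log_nat_power)
  then have "card S * log 2 (card S) \<le> card S * real l" by (intro mult_left_mono) auto
  then have "real (\<Sum>x\<in>S. card {i. i < d \<and> flip i x \<in> S}) \<le> real (card S * l)"
    using sum_inner_degree_le[OF assms(1)] by simp
  then show ?thesis by (simp only: of_nat_le_iff)
qed

lemma card_inner_edges_le:
  assumes "E \<subseteq> cube_edges d" "S \<subseteq> cube_vertices d" "card S \<le> 2 ^ l"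
  shows "card {e \<in> E. e \<subseteq> S} \<le> card S * l"
proof -
  have fin: "finite S" by (rule finite_subset[OF assms(2)]) simp
  let ?P = "SIGMA x:S. {i. i < d \<and> flip i x \<in> S}"
  have "{e \<in> E. e \<subseteq> S} \<subseteq> (\<lambda>(x, i). {x, flip i x}) ` ?P"
  proof
    fix e assume e: "e \<in> {e \<in> E. e \<subseteq> S}"
    then have "e \<in> cube_edges d" using assms(1) by blast
    then obtain x i where "e = {x, flip i x}" "i < d" by (rule cube_edge_cases)
    then show "e \<in> (\<lambda>(x, i). {x, flip i x}) ` ?P"
      using e by (intro image_eqI[of _ _ "(x, i)"]) auto
  qed
  then have "card {e \<in> E. e \<subseteq> S} \<le> card ?P"
    using fin by (intro surj_card_le) auto
  also have "\<dots> \<le> card S * l"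
    using sum_inner_degree_le_nat[OF assms(2,3)] fin by (simp add: card_SigmaI)
  finally show ?thesis .
qed

text \<open>Each vertex of \<open>S\<close> has at least \<open>D\<close> edges in \<open>E\<close>,
  of which on average at most \<open>l\<close> stay inside \<open>S\<close>. Allowing
  \<open>E\<close> to be smaller than the cube is what makes the bound available in
  subcubes.\<close>

lemma card_edge_boundary_ge:
  assumes "E \<subseteq> cube_edges d" "S \<subseteq> cube_vertices d" "card S \<le> 2 ^ l"
    and "\<And>u. u \<in> S \<Longrightarrow> D \<le> card {i. i < d \<and> {u, flip i u} \<in> E}"
  shows "card S * (D - l) \<le> card (edge_boundary E S)"
proof -
  have fin: "finite S" by (rule finite_subset[OF assms(2)]) simp
  have finE: "finite (edge_boundary E S)"
    using finite_subset[OF assms(1)] by (simp add: edge_boundary_def)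
  let ?P = "SIGMA x:S. {i. i < d \<and> {x, flip i x} \<in> E \<and> flip i x \<notin> S}"
  have inj: "inj_on (\<lambda>(x, i). {x, flip i x}) ?P"
    by (auto simp: inj_on_def doubleton_eq_iff)
  have "(\<lambda>(x, i). {x, flip i x}) ` ?P \<subseteq> edge_boundary E S"
    unfolding subset_iff edge_boundary_iff[OF assms(1)] by auto
  then have "card ?P \<le> card (edge_boundary E S)"
    using card_inj_on_le[OF inj _ finE] by blast
  moreover have "card S * D \<le> card ?P + card S * l"
  proof -
    have "card S * D \<le> (\<Sum>x\<in>S. card {i. i < d \<and> {x, flip i x} \<in> E})"
      using sum_mono[of S "\<lambda>_. D", OF assms(4)] by simp
    also have "\<dots> \<le> (\<Sum>x\<in>S. card {i. i < d \<and> {x, flip i x} \<in> E \<and> flip i x \<notin> S}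
        + card {i. i < d \<and> flip i x \<in> S})"
    proof (intro sum_mono)
      fix x
      have "card {i. i < d \<and> {x, flip i x} \<in> E}
        \<le> card ({i. i < d \<and> {x, flip i x} \<in> E \<and> flip i x \<notin> S} \<union> {i. i < d \<and> flip i x \<in> S})"
        by (intro card_mono) auto
      then show "card {i. i < d \<and> {x, flip i x} \<in> E}
        \<le> card {i. i < d \<and> {x, flip i x} \<in> E \<and> flip i x \<notin> S} + card {i. i < d \<and> flip i x \<in> S}"
        using card_Un_le order_trans by blast
    qed
    also have "\<dots> = card ?P + (\<Sum>x\<in>S. card {i. i < d \<and> flip i x \<in> S})"
      using fin by (simp add: sum.distrib card_SigmaI)
    finally show ?thesis using sum_inner_degree_le_nat[OF assms(2,3)] by linarith
  qed
  ultimately show ?thesis by (simp add: diff_mult_distrib2)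
qed

text \<open>Here \<open>s\<close> stands for the size of a vertex set, \<open>t\<close> for its tree
  edges, \<open>e\<close> for all its inner edges and \<open>b\<close> for its boundary edges.
  Raising the density from \<open>1 / d\<close> to \<open>(1 + x) / d\<close> gains at most
  \<open>(1 + x) ^ s\<close> on the tree and loses \<open>exp (- x / d)\<close> per boundary edge.
  Forbidding the remaining inner edges on the right costs at most \<open>exp (2 / d)\<close> for
  each of them. For \<open>l\<close> small against \<open>d\<close> and \<open>D\<close> near
  \<open>d\<close> the rate is close to \<open>(1 + x) * exp (- x)\<close>, which is below 1 for
  positive \<open>x\<close>.\<close>

lemma weight_comparison:
  fixes x \<rho> :: real and d l D s t e b :: nat
  assumes "2 \<le> d" "0 \<le> x" "1 + x \<le> d" "l \<le> D"
    and t: "t \<le> s" "e \<le> s * l" "s * (D - l) \<le> b"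
    and \<rho>: "(1 + x) * exp (2 * l / d - x / d * (D - l)) \<le> \<rho>"
  shows "((1 + x) / d) ^ t * (1 - (1 + x) / d) ^ b
    \<le> \<rho> ^ s * ((1 / d) ^ t * (1 - 1 / d) ^ (e - t + b))"
proof -
  define q where "q = 1 / real d"
  have q: "0 < q" "q \<le> 1 / 2" "(1 + x) * q \<le> 1" using assms by (auto simp: q_def field_simps)
  have "(1 - (1 + x) * q) ^ b \<le> ((1 - q) * exp (- x * q)) ^ b"
  proof (intro power_mono)
    have "1 - (1 + x) * q \<le> (1 - q) * (1 + - x * q)"
      using assms(2) q by (simp add: algebra_simps)
    also have "\<dots> \<le> (1 - q) * exp (- x * q)"
      using q exp_ge_add_one_self[of "- x * q"] by (intro mult_left_mono) simp_all
    finally show "1 - (1 + x) * q \<le> (1 - q) * exp (- x * q)" .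
  qed (use q in simp)
  also have "\<dots> = (1 - q) ^ b * exp (- x * q * b)"
    by (simp add: power_mult_distrib mult.commute flip: exp_of_nat_mult)
  also have "\<dots> \<le> (1 - q) ^ b * exp (- x * q * (D - l)) ^ s"
  proof (intro mult_left_mono)
    have "real (s * (D - l)) \<le> b" using t(3) by (simp only: of_nat_le_iff)
    then have "x * q * (D - l) * s \<le> x * q * b"
      using assms(2) q(1) mult_left_mono[of "real (s * (D - l))" b "x * q"] by (simp add: mult_ac)
    then show "exp (- x * q * b) \<le> exp (- x * q * (D - l)) ^ s"
      by (simp flip: exp_of_nat_mult add: mult_ac)
  qed (use q in simp)
  finally have 1: "(1 - (1 + x) * q) ^ b \<le> (1 - q) ^ b * exp (- x * q * (D - l)) ^ s" .
  have "1 \<le> (1 - q) * (1 + 2 * q)"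
    using q mult_mono[of q "1/2" q q] by (simp add: algebra_simps)
  also have "\<dots> \<le> (1 - q) * exp (2 * q)"
    using q exp_ge_add_one_self by (intro mult_left_mono) auto
  finally have "1 \<le> ((1 - q) * exp (2 * q)) ^ (e - t)" by (rule one_le_power)
  also have "\<dots> = (1 - q) ^ (e - t) * exp (2 * q) ^ (e - t)" by (rule power_mult_distrib)
  also have "\<dots> \<le> (1 - q) ^ (e - t) * exp (2 * q) ^ (s * l)"
    using q t(2) by (intro mult_left_mono power_increasing) auto
  also have "exp (2 * q) ^ (s * l) = exp (2 * q * l) ^ s"
    by (simp flip: exp_of_nat_mult add: mult_ac)
  finally have 2: "1 \<le> (1 - q) ^ (e - t) * exp (2 * q * l) ^ s" .
  have 3: "((1 + x) * q) ^ t \<le> (1 + x) ^ s * q ^ t"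
    unfolding power_mult_distrib using assms(2) t(1) q
    by (intro mult_right_mono power_increasing) auto
  have "((1 + x) * q) ^ t * (1 - (1 + x) * q) ^ b * 1
    \<le> ((1 + x) ^ s * q ^ t) * ((1 - q) ^ b * exp (- x * q * (D - l)) ^ s)
      * ((1 - q) ^ (e - t) * exp (2 * q * l) ^ s)"
    using assms(2) q by (intro mult_mono 1 2 3) auto
  also have "\<dots> = ((1 + x) * (exp (- x * q * (D - l)) * exp (2 * q * l))) ^ s
      * (q ^ t * (1 - q) ^ (e - t + b))"
    by (simp add: power_mult_distrib power_add mult_ac)
  also have "\<dots> \<le> \<rho> ^ s * (q ^ t * (1 - q) ^ (e - t + b))"
  proof (intro mult_right_mono power_mono)
    have "exp (- x * q * (D - l)) * exp (2 * q * l) = exp (2 * l / d - x / d * (D - l))"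
      by (simp add: q_def flip: exp_add)
    then show "(1 + x) * (exp (- x * q * (D - l)) * exp (2 * q * l)) \<le> \<rho>"
      using \<rho> by simp
  qed (use assms(2) q in auto)
  finally show ?thesis by (simp add: q_def)
qed

text \<open>At the higher density, bound by a union over spanning trees of \<open>S\<close>, with
  the boundary closed. At density \<open>1 / d\<close>, also require all inner edges outside the
  tree to be absent: these events are disjoint for different trees, so their probabilities sum to at
  most that of \<open>component F v = S\<close>. The number of trees thus never has to be
  estimated.\<close>

lemma bprob_component_eq_le:
  fixes x \<rho> :: real and d l D :: nat
  assumes dx: "2 \<le> d" "0 \<le> x" "1 + x \<le> d" "l \<le> D"
    and \<rho>: "(1 + x) * exp (2 * l / d - x / d * (D - l)) \<le> \<rho>"
    and E: "E \<subseteq> cube_edges d" and S: "S \<subseteq> cube_vertices d" "card S \<le> 2 ^ l"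
    and deg: "\<And>u. u \<in> S \<Longrightarrow> D \<le> card {i. i < d \<and> {u, flip i u} \<in> E}"
  shows "bprob E ((1 + x) / d) (\<lambda>F. component F v = S)
    \<le> \<rho> ^ card S * bprob E (1 / d) (\<lambda>F. component F v = S)"
proof -
  define p q where "p = (1 + x) / real d" and "q = 1 / real d"
  have pq: "0 \<le> p" "p \<le> 1" "0 \<le> q" "q \<le> 1" using dx by (auto simp: p_def q_def)
  have "0 < (1 + x) * exp (2 * l / d - x / d * (D - l))" using dx(2) by simp
  then have \<rho>0: "0 \<le> \<rho>" using \<rho> by linarith
  have finE: "finite E" by (rule finite_subset[OF E]) simp
  have finS: "finite S" by (rule finite_subset[OF S(1)]) simp
  define I B where "I = {e \<in> E. e \<subseteq> S}" and "B = edge_boundary E S"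
  have IB: "I \<subseteq> E" "B \<subseteq> E" "I \<inter> B = {}"
  proof -
    show "I \<subseteq> E" "B \<subseteq> E" by (auto simp: I_def B_def edge_boundary_def)
    show "I \<inter> B = {}"
      unfolding I_def B_def edge_boundary_iff[OF E] disjoint_iff by blast
  qed
  have fin: "finite I" "finite B" using IB finE finite_subset by blast+
  \<comment> \<open>Connecting \<open>S\<close> with fewer than \<open>card S\<close> edges forces
    \<open>T\<close> to be a spanning tree of \<open>S\<close>.\<close>
  define \<T> where "\<T> = {T. T \<subseteq> I \<and> card T < card S \<and> component T v = S}"
  have fin\<T>: "finite \<T>"
    by (rule finite_subset[of _ "Pow I"]) (use fin in \<open>auto simp: \<T>_def\<close>)
  have T: "T \<subseteq> I" "card T < card S" "component T v = S" "T \<subseteq> E" if "T \<in> \<T>" for T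
    using that IB by (auto simp: \<T>_def)
  have "bprob E p (\<lambda>F. component F v = S) \<le> (\<Sum>T\<in>\<T>. bprob E p (\<lambda>F. T \<subseteq> F \<and> F \<inter> B = {}))"
  proof (rule bprob_union_bound[OF pq(1,2) fin\<T>])
    fix F assume F: "F \<subseteq> E" "component F v = S"
    obtain T where T: "T \<subseteq> F" "\<And>e. e \<in> T \<Longrightarrow> e \<subseteq> S" "card T < card S" "component T v = S"
      using component_spanning_tree[of F v] finS F(2) by metis
    have "T \<in> \<T>" using T F(1) by (auto simp: \<T>_def I_def)
    moreover have "F \<inter> B = {}"
    proof -
      have "F \<subseteq> cube_edges d" using F(1) E by blast
      then have "edge_boundary F S = {}" using edge_boundary_component F(2) by blast
      then show ?thesis by (auto simp: B_def edge_boundary_def)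
    qed
    ultimately show "\<exists>T\<in>\<T>. T \<subseteq> F \<and> F \<inter> B = {}" using T(1) by blast
  qed
  also have "\<dots> = (\<Sum>T\<in>\<T>. p ^ card T * (1 - p) ^ card B)"
    using T IB by (intro sum.cong refl bprob_cylinder[OF finE]) blast+
  also have "\<dots> \<le> (\<Sum>T\<in>\<T>. \<rho> ^ card S * (q ^ card T * (1 - q) ^ (card I - card T + card B)))"
    unfolding p_def q_def
  proof (intro sum_mono weight_comparison[OF dx _ _ _ \<rho>])
    fix U assume "U \<in> \<T>"
    then show "card U \<le> card S" using T(2) less_imp_le by blast
    show "card I \<le> card S * l" unfolding I_def by (rule card_inner_edges_le[OF E S])
    show "card S * (D - l) \<le> card B" unfolding B_def using deg by (rule card_edge_boundary_ge[OF E S])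
  qed
  also have "\<dots> = \<rho> ^ card S * (\<Sum>T\<in>\<T>. q ^ card T * (1 - q) ^ card ((I - T) \<union> B))"
    unfolding sum_distrib_left
  proof (intro sum.cong refl)
    fix U assume U: "U \<in> \<T>"
    have "card ((I - U) \<union> B) = card (I - U) + card B"
      using fin IB by (intro card_Un_disjoint) auto
    also have "card (I - U) = card I - card U"
      using T(1)[OF U] fin by (meson card_Diff_subset finite_subset)
    finally show "\<rho> ^ card S * (q ^ card U * (1 - q) ^ (card I - card U + card B))
      = \<rho> ^ card S * (q ^ card U * (1 - q) ^ card ((I - U) \<union> B))" by simp
  qed
  also have "(\<Sum>T\<in>\<T>. q ^ card T * (1 - q) ^ card ((I - T) \<union> B))
      = (\<Sum>T\<in>\<T>. bprob E q (\<lambda>F. T \<subseteq> F \<and> F \<inter> ((I - T) \<union> B) = {}))"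
  proof (intro sum.cong refl bprob_cylinder[OF finE, symmetric])
    fix U assume "U \<in> \<T>"
    then show "U \<subseteq> E" "(I - U) \<union> B \<subseteq> E" "U \<inter> ((I - U) \<union> B) = {}"
      using T[of U] IB by blast+
  qed
  also have "\<dots> \<le> bprob E q (\<lambda>F. component F v = S)"
    unfolding bexp_sum[symmetric]
  proof (intro bexp_mono pq)
    fix F assume F: "F \<subseteq> E"
    let ?P = "\<lambda>T. T \<subseteq> F \<and> F \<inter> ((I - T) \<union> B) = {}"
    \<comment> \<open>Disjointness of the events: the tree is read off from \<open>F\<close> as its
      set of inner edges.\<close>
    have unique: "U = F \<inter> I" if "U \<in> \<T>" "?P U" for U
    proof
      show "U \<subseteq> F \<inter> I" using that T(1)[of U] by blast
      show "F \<inter> I \<subseteq> U" using that(2) by blast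
    qed
    show "(\<Sum>T\<in>\<T>. of_bool (?P T)) \<le> (of_bool (component F v = S) :: real)"
    proof (cases "F \<inter> I \<in> \<T> \<and> ?P (F \<inter> I)")
      case True
      have "(\<Sum>T\<in>\<T>. of_bool (?P T)) \<le> (\<Sum>T\<in>\<T>. if T = F \<inter> I then 1 else 0 :: real)"
      proof (rule sum_mono)
        fix U assume U: "U \<in> \<T>"
        show "of_bool (?P U) \<le> (if U = F \<inter> I then 1 else 0 :: real)"
        proof (cases "?P U")
          case True
          then show ?thesis using unique[OF U True] by simp
        next
          case False
          then have 0: "of_bool (?P U) = (0 :: real)" by (simp only: of_bool_eq)
          show ?thesis unfolding 0 by simp
        qed
      qed
      then have le: "(\<Sum>T\<in>\<T>. of_bool (?P T)) \<le> (1 :: real)"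
        using fin\<T> True by simp
      have comp: "component (F \<inter> I) v = S" using T(3) True by blast
      have "S \<subseteq> component F v"
        using component_mono[of "F \<inter> I" F v] comp by blast
      moreover have "edge_boundary F S = {}"
        using True F by (auto simp: B_def edge_boundary_def)
      then have "component F v \<subseteq> S"
        using comp component_refl by (intro component_least) blast+
      ultimately show ?thesis using le by simp
    next
      case False
      have "of_bool (?P U) = (0 :: real)" if "U \<in> \<T>" for U
      proof -
        have "\<not> ?P U" using False unique[OF that] that by auto
        then show ?thesis by (simp only: of_bool_eq)
      qed
      then have "(\<Sum>T\<in>\<T>. of_bool (?P T)) = (0 :: real)" by (rule sum.neutral[OF ballI])
      then show ?thesis by simp
    qed
  qed
  finally show ?thesis using \<rho>0 unfolding p_def q_def by (simp add: mult_left_mono)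
qed

text \<open>Sum the comparison over all sets \<open>S\<close> of size from \<open>k\<close> up to
  \<open>K\<close>. Each gains a factor at most \<open>\<rho> ^ k\<close>, and the events
  \<open>component F v = S\<close> at density \<open>1 / d\<close> are disjoint, so their
  probabilities add up to at most 1.\<close>

lemma bprob_component_size_le:
  fixes x \<rho> :: real and d l D k K :: nat
  assumes dx: "2 \<le> d" "0 \<le> x" "1 + x \<le> d" "l \<le> D"
    and \<rho>: "(1 + x) * exp (2 * l / d - x / d * (D - l)) \<le> \<rho>" "\<rho> \<le> 1"
    and E: "E \<subseteq> cube_edges d" "\<And>e. e \<in> E \<Longrightarrow> e \<subseteq> U"
    and U: "U \<subseteq> cube_vertices d" "v \<in> U"
    and deg: "\<And>u. u \<in> U \<Longrightarrow> D \<le> card {i. i < d \<and> {u, flip i u} \<in> E}"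
    and K: "K \<le> 2 ^ l"
  shows "bprob E ((1 + x) / d) (\<lambda>F. k \<le> card (component F v) \<and> card (component F v) < K) \<le> \<rho> ^ k"
proof -
  have finE: "finite E" by (rule finite_subset[OF E(1)]) simp
  have finU: "finite U" by (rule finite_subset[OF U(1)]) simp
  have p: "0 \<le> (1 + x) / d" "(1 + x) / d \<le> 1" "0 \<le> 1 / real d" "1 / real d \<le> 1" using dx by auto
  have "0 < (1 + x) * exp (2 * l / d - x / d * (D - l))" using dx(2) by simp
  then have \<rho>0: "0 \<le> \<rho>" using \<rho> by linarith
  define \<S> where "\<S> = {S. S \<subseteq> U \<and> k \<le> card S \<and> card S < K}"
  have fin\<S>: "finite \<S>"
    by (rule finite_subset[of _ "Pow U"]) (use finU in \<open>auto simp: \<S>_def\<close>)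
  have comp: "component F v \<subseteq> U" if "F \<subseteq> E" for F
    using that E(2) U(2) by (intro component_subset) blast+
  have "bprob E ((1 + x) / d) (\<lambda>F. k \<le> card (component F v) \<and> card (component F v) < K)
    \<le> (\<Sum>S\<in>\<S>. bprob E ((1 + x) / d) (\<lambda>F. component F v = S))"
    using comp by (intro bprob_union_bound p fin\<S>) (auto simp: \<S>_def)
  also have "\<dots> \<le> (\<Sum>S\<in>\<S>. \<rho> ^ k * bprob E (1 / d) (\<lambda>F. component F v = S))"
  proof (rule sum_mono)
    fix S assume S: "S \<in> \<S>"
    have "bprob E ((1 + x) / d) (\<lambda>F. component F v = S)
      \<le> \<rho> ^ card S * bprob E (1 / d) (\<lambda>F. component F v = S)"
      using S K U(1) deg
      by (intro bprob_component_eq_le[OF dx \<rho>(1) E(1)]) (auto simp: \<S>_def)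
    also have "\<dots> \<le> \<rho> ^ k * bprob E (1 / d) (\<lambda>F. component F v = S)"
      using S \<rho>0 \<rho>(2) by (intro mult_right_mono power_decreasing bexp_nonneg p) (auto simp: \<S>_def)
    finally show "bprob E ((1 + x) / d) (\<lambda>F. component F v = S)
      \<le> \<rho> ^ k * bprob E (1 / d) (\<lambda>F. component F v = S)" .
  qed
  also have "\<dots> = \<rho> ^ k * bexp E (1 / d) (\<lambda>F. \<Sum>S\<in>\<S>. of_bool (component F v = S))"
    by (simp add: bexp_sum sum_distrib_left)
  also have "\<dots> \<le> \<rho> ^ k * bexp E (1 / d) (\<lambda>F. 1)"
    using fin\<S> \<rho>0 by (intro mult_left_mono bexp_mono p) (auto simp: of_bool_def)
  finally show ?thesis using bexp_const[OF finE] by simp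
qed

section \<open>Big components\<close>

lemma bexp_marginal:
  assumes "finite E" "A \<subseteq> E" "depends_on A f"
  shows "bexp E p f = bexp A p f"
proof -
  have "finite (E - A)" "(E - A) \<inter> A = {}" using assms by auto
  then have "bexp (A \<union> (E - A)) p f = bexp A p f"
  proof (induction rule: finite_induct)
    case (insert e B)
    have "f (insert e F) = f F" for F
      using insert.prems by (intro depends_onD[OF assms(3)]) auto
    moreover have "finite (A \<union> B)" "e \<notin> A \<union> B"
      using insert assms finite_subset by auto
    ultimately show ?case
      using insert by (simp add: bexp_insert algebra_simps)
  qed simp
  then show ?thesis using assms(2) by (simp add: Un_absorb1)
qed

lemma markov_count:
  assumes "0 \<le> p" "p \<le> 1" "0 < t" "finite V"
  shows "bprob E p (\<lambda>F. t \<le> real (card {x \<in> V. P x F})) \<le> (\<Sum>x\<in>V. bprob E p (P x)) / t"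
proof -
  have card: "real (card {x \<in> V. P x F}) = (\<Sum>x\<in>V. of_bool (P x F))" for F
    using assms(4) by (simp add: Int_def)
  show ?thesis
    using markov_bprob[OF assms(1-3), of E "\<lambda>F. real (card {x \<in> V. P x F})"]
    unfolding card bexp_sum by (simp add: sum_nonneg)
qed

section \<open>Growth of components in the second round\<close>

lemma component_subset_cube:
  assumes "F \<subseteq> cube_edges d" "v \<in> cube_vertices d"
  shows "component F v \<subseteq> cube_vertices d"
proof (rule component_subset[OF assms(2)])
  fix u w assume "u \<in> cube_vertices d" "{u, w} \<in> F"
  then obtain i where "i < d" "{u, w} = {u, flip i u}" "u \<in> cube_vertices d"
    using assms(1) by (meson cube_edgeE insertI1 subsetD)
  then show "w \<in> cube_vertices d" by (auto simp: doubleton_eq_iff)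
qed

lemma finite_component:
  assumes "F \<subseteq> cube_edges d" "v \<in> cube_vertices d"
  shows "finite (component F v)"
  using component_subset_cube[OF assms] by (rule finite_subset) simp

lemma card_edge_boundary_le:
  assumes "F \<subseteq> cube_edges d" "finite S"
  shows "card (edge_boundary F S) \<le> card S * d"
proof -
  have "edge_boundary F S \<subseteq> (\<lambda>(x, i). {x, flip i x}) ` (S \<times> {..<d})"
  proof
    fix e assume "e \<in> edge_boundary F S"
    then obtain x i where "x \<in> S" "i < d" "e = {x, flip i x}"
      unfolding edge_boundary_iff[OF assms(1)] by blast
    then show "e \<in> (\<lambda>(x, i). {x, flip i x}) ` (S \<times> {..<d})"
      by (intro image_eqI[of _ _ "(x, i)"]) simp_all
  qed
  then have "card (edge_boundary F S) \<le> card (S \<times> {..<d})"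
    using assms(2) by (intro surj_card_le) auto
  then show ?thesis by (simp add: card_cartesian_product)
qed

lemma component_Un_eq:
  assumes "F1 \<subseteq> cube_edges d" "edge_boundary F2 (component F1 v) = {}"
  shows "component (F1 \<union> F2) v = component F1 v"
proof
  have "edge_boundary (F1 \<union> F2) (component F1 v) = {}"
    using edge_boundary_component[OF assms(1), of v] assms(2) by (auto simp: edge_boundary_def)
  then show "component (F1 \<union> F2) v \<subseteq> component F1 v"
    by (intro component_least) simp_all
qed (rule component_mono, simp)

text \<open>If the component in \<open>F1\<close> already has \<open>k\<close> vertices, the event
  does not involve \<open>F2\<close>. Otherwise fewer than \<open>k\<close> vertices have at most
  \<open>k * d\<close> edges leaving them, and one of these must be in \<open>F2\<close>.\<close>

lemma bprob_component_jump_le: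
  fixes p2 :: real and k K :: nat
  assumes p2: "0 \<le> p2" "p2 \<le> 1" and F1: "F1 \<subseteq> cube_edges d" and v: "v \<in> cube_vertices d"
  shows "bprob (cube_edges d) p2 (\<lambda>F2. k \<le> card (component (F1 \<union> F2) v) \<and> card (component F1 v) < K)
    \<le> of_bool (k \<le> card (component F1 v) \<and> card (component F1 v) < K) + k * d * p2"
proof (cases "k \<le> card (component F1 v)")
  case True
  let ?E = "cube_edges d"
    and ?P = "\<lambda>F2. k \<le> card (component (F1 \<union> F2) v) \<and> card (component F1 v) < K"
    and ?Q = "k \<le> card (component F1 v) \<and> card (component F1 v) < K"
  have "bprob ?E p2 ?P \<le> bexp ?E p2 (\<lambda>_. of_bool ?Q)"
    using True by (intro bexp_mono p2) auto
  also have "\<dots> = of_bool ?Q" by (rule bexp_const) simp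
  finally show ?thesis
    by (rule order_trans) (use p2 in simp)
next
  case False
  let ?E = "cube_edges d"
    and ?P = "\<lambda>F2. k \<le> card (component (F1 \<union> F2) v) \<and> card (component F1 v) < K"
  let ?B = "edge_boundary ?E (component F1 v)"
  have B: "?B \<subseteq> ?E" by (auto simp: edge_boundary_def)
  have "bprob ?E p2 ?P \<le> bprob ?E p2 (\<lambda>F2. F2 \<inter> ?B \<noteq> {})"
  proof (intro bprob_mono p2)
    fix F2 assume F2: "F2 \<subseteq> ?E" "?P F2"
    show "F2 \<inter> ?B \<noteq> {}"
    proof
      assume "F2 \<inter> ?B = {}"
      then have "edge_boundary F2 (component F1 v) = {}"
        using F2(1) by (auto simp: edge_boundary_def)
      then have "component (F1 \<union> F2) v = component F1 v" by (rule component_Un_eq[OF F1])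
      then show False using F2(2) False by simp
    qed
  qed
  also have "\<dots> = 1 - (1 - p2) ^ card ?B" by (rule bprob_meets[OF _ B]) simp
  also have "\<dots> \<le> card ?B * p2"
    using Bernoulli_inequality[of "- p2" "card ?B"] p2 by simp
  also have "\<dots> \<le> real (k * d) * p2"
  proof (intro mult_right_mono p2)
    have "card ?B \<le> card (component F1 v) * d"
      by (intro card_edge_boundary_le finite_component[OF F1 v]) simp
    also have "\<dots> \<le> k * d" using False by simp
    finally show "real (card ?B) \<le> real (k * d)" by (simp only: of_nat_le_iff)
  qed
  finally show ?thesis by (simp add: add_increasing)
qed

text \<open>Markov's inequality for the second round, averaged over the first. With
  \<open>p2\<close> of order \<delta>/d the second summand is of order k times \<delta>, so it is
  made small by fixing \<open>k\<close> first and \<delta> afterwards.\<close>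

lemma component_jump_count:
  fixes p1 p2 t \<eta> :: real and k K :: nat
  assumes p: "0 \<le> p1" "p1 \<le> 1" "0 \<le> p2" "p2 \<le> 1" and "0 < t"
    and \<eta>: "\<And>v. v \<in> cube_vertices d \<Longrightarrow> bprob (cube_edges d) p1
      (\<lambda>F. k \<le> card (component F v) \<and> card (component F v) < K) \<le> \<eta>"
  shows "bexp (cube_edges d) p1 (\<lambda>F1. bprob (cube_edges d) p2 (\<lambda>F2. t \<le> real (card
      {v \<in> cube_vertices d. k \<le> card (component (F1 \<union> F2) v) \<and> card (component F1 v) < K})))
    \<le> 2 ^ d * (\<eta> + k * d * p2) / t"
proof -
  let ?E = "cube_edges d" and ?V = "cube_vertices d"
  have "bexp ?E p1 (\<lambda>F1. bprob ?E p2 (\<lambda>F2. t \<le> real (card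
      {v \<in> ?V. k \<le> card (component (F1 \<union> F2) v) \<and> card (component F1 v) < K})))
    \<le> bexp ?E p1 (\<lambda>F1. (1 / t) * (\<Sum>v\<in>?V.
        of_bool (k \<le> card (component F1 v) \<and> card (component F1 v) < K) + k * d * p2))"
  proof (intro bexp_mono p)
    fix F1 assume F1: "F1 \<subseteq> ?E"
    have "bprob ?E p2 (\<lambda>F2. t \<le> real (card
        {v \<in> ?V. k \<le> card (component (F1 \<union> F2) v) \<and> card (component F1 v) < K}))
      \<le> (\<Sum>v\<in>?V. bprob ?E p2 (\<lambda>F2. k \<le> card (component (F1 \<union> F2) v) \<and> card (component F1 v) < K)) / t"
      by (intro markov_count p assms(5)) simp
    also have "\<dots> \<le> (\<Sum>v\<in>?V. of_bool (k \<le> card (component F1 v) \<and> card (component F1 v) < K) + k * d * p2) / t"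
      using assms(5) by (intro divide_right_mono sum_mono bprob_component_jump_le p F1) auto
    finally show "bprob ?E p2 (\<lambda>F2. t \<le> real (card
        {v \<in> ?V. k \<le> card (component (F1 \<union> F2) v) \<and> card (component F1 v) < K}))
      \<le> (1 / t) * (\<Sum>v\<in>?V. of_bool (k \<le> card (component F1 v) \<and> card (component F1 v) < K) + k * d * p2)"
      by simp
  qed
  also have "\<dots> = (1 / t) * (\<Sum>v\<in>?V. bprob ?E p1
      (\<lambda>F. k \<le> card (component F v) \<and> card (component F v) < K) + k * d * p2)"
    unfolding bexp_cmult bexp_sum bexp_add bexp_const[OF finite_cube_edges] ..
  also have "\<dots> \<le> (1 / t) * (\<Sum>v\<in>?V. \<eta> + k * d * p2)"
    using assms(5) \<eta> by (intro mult_left_mono sum_mono add_right_mono) auto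
  finally show ?thesis by (simp add: card_cube_vertices)
qed

text \<open>Flipping the coordinate \<open>i < g\<close> and then freezing the coordinates below \<open>g\<close> puts the
  neighbours of \<open>x\<close> into disjoint subcubes, in which their components are independent.\<close>

lemma bprob_few_big_neighbours:
  fixes x \<rho> r :: real and d l g K :: nat
  assumes dx: "2 \<le> d" "0 \<le> x" "1 + x \<le> d" "l \<le> d - g" "g \<le> d"
    and \<rho>: "(1 + x) * exp (2 * l / d - x / d * (d - g - l)) \<le> \<rho>" "\<rho> \<le> 1"
    and K: "K \<le> 2 ^ l" and v: "v \<in> cube_vertices d"
  shows "bprob (cube_edges d) ((1 + x) / d)
      (\<lambda>F. real (card {i. i < d \<and> K \<le> card (component F (flip i v))}) \<le> r)
    \<le> exp (r - (1 - \<rho>) * g / 2)"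
proof -
  let ?E = "cube_edges d" and ?V = "cube_vertices d" and ?p = "(1 + x) / d"
  have p: "0 \<le> ?p" "?p \<le> 1" using dx by auto
  define U where "U i = {u \<in> ?V. u \<inter> {..<g} = flip i v \<inter> {..<g}}" for i
  define Ei where "Ei i = {e \<in> ?E. e \<subseteq> U i}" for i
  define Q where "Q i F \<longleftrightarrow> K \<le> card (component (F \<inter> Ei i) (flip i v))" for i F
  have Ei: "Ei i \<subseteq> ?E" for i by (auto simp: Ei_def)
  have U: "U i \<subseteq> ?V" for i by (auto simp: U_def)
  have vU: "flip i v \<in> U i" if "i < g" for i using that v dx(5) by (simp add: U_def)
  have disjU: "U i \<inter> U j = {}" if "i < g" "j < g" "i \<noteq> j" for i j
  proof -
    have "flip i v \<inter> {..<g} \<noteq> flip j v \<inter> {..<g}"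
    proof
      assume "flip i v \<inter> {..<g} = flip j v \<inter> {..<g}"
      then have "i \<in> flip i v \<longleftrightarrow> i \<in> flip j v" using that(1) by blast
      then show False using that(3) by (simp add: mem_flip_iff)
    qed
    then show ?thesis by (auto simp: U_def)
  qed
  have disj: "disjoint_family_on Ei {..<g}"
    unfolding disjoint_family_on_def
  proof (intro ballI impI)
    fix i j assume ij: "i \<in> {..<g}" "j \<in> {..<g}" "i \<noteq> j"
    have "e \<notin> Ei j" if e: "e \<in> Ei i" for e
    proof
      assume "e \<in> Ei j"
      then have "e \<subseteq> {}" using e disjU[of i j] ij by (auto simp: Ei_def)
      moreover have "e \<noteq> {}"
        using e by (auto simp: Ei_def elim!: cube_edge_cases)
      ultimately show False by simp
    qed
    then show "Ei i \<inter> Ei j = {}" by blast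
  qed
  have dep: "depends_on (Ei i) (Q i)" for i
    by (rule depends_onI) (simp add: Q_def Int_assoc)
  have deg: "d - g \<le> card {j. j < d \<and> {u, flip j u} \<in> Ei i}" if u: "u \<in> U i" for u i
  proof -
    have "{g..<d} \<subseteq> {j. j < d \<and> {u, flip j u} \<in> Ei i}"
    proof
      fix j assume j: "j \<in> {g..<d}"
      have "flip j u \<inter> {..<g} = u \<inter> {..<g}" using j by (auto simp: mem_flip_iff)
      then show "j \<in> {j. j < d \<and> {u, flip j u} \<in> Ei i}"
        using u j by (simp add: Ei_def U_def)
    qed
    then show ?thesis using card_mono[of "{j. j < d \<and> {u, flip j u} \<in> Ei i}" "{g..<d}"] by simp
  qed
  have prob: "1 - \<rho> \<le> bprob ?E ?p (Q i)" if i: "i \<in> {..<g}" for i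
  proof -
    have depB: "depends_on (Ei i) (\<lambda>F. of_bool (Q i F) :: real)"
      using dep[of i] by (simp add: depends_on_def)
    have finEi: "finite (Ei i)" by (rule finite_subset[OF Ei]) simp
    have "bprob ?E ?p (Q i) = bprob (Ei i) ?p (Q i)"
      by (rule bexp_marginal[OF _ Ei depB]) simp
    also have "\<dots> = 1 - bprob (Ei i) ?p (\<lambda>F. \<not> Q i F)"
      by (simp only: bprob_not[OF finEi])
    finally have eq: "bprob ?E ?p (Q i) = 1 - bprob (Ei i) ?p (\<lambda>F. \<not> Q i F)" .
    \<comment> \<open>A component is never empty, so failing to reach \<open>K\<close> means a size
      from 1 up to \<open>K\<close>; the size estimate with exponent 1 then bounds the failure by
      \<open>\<rho>\<close>.\<close>
    have "bprob (Ei i) ?p (\<lambda>F. \<not> Q i F)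
      \<le> bprob (Ei i) ?p (\<lambda>F. 1 \<le> card (component F (flip i v)) \<and> card (component F (flip i v)) < K)"
    proof (intro bprob_mono p conjI)
      fix F assume F: "F \<subseteq> Ei i" "\<not> Q i F"
      then have "F \<inter> Ei i = F" by blast
      then show "card (component F (flip i v)) < K" using F(2) by (simp add: Q_def)
      have "finite (component F (flip i v))"
        using F(1) Ei[of i] v i dx(5) by (intro finite_component[of F d]) auto
      then show "1 \<le> card (component F (flip i v))"
        using component_refl by (metis Suc_leI One_nat_def card_gt_0_iff empty_iff)
    qed
    also have "\<dots> \<le> \<rho> ^ 1"
      using i \<rho>(1) dx deg[of _ i] vU
      by (intro bprob_component_size_le[where U = "U i" and D = "d - g" and l = l] dx \<rho>(2) Ei U K)
         (auto simp: Ei_def of_nat_diff)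
    finally show ?thesis unfolding eq by simp
  qed
  have "bprob ?E ?p (\<lambda>F. real (card {i. i < d \<and> K \<le> card (component F (flip i v))}) \<le> r)
    \<le> bprob ?E ?p (\<lambda>F. real (card {i \<in> {..<g}. Q i F}) \<le> r)"
  proof (intro bprob_mono p)
    fix F assume F: "F \<subseteq> ?E" "real (card {i. i < d \<and> K \<le> card (component F (flip i v))}) \<le> r"
    have "{i \<in> {..<g}. Q i F} \<subseteq> {i. i < d \<and> K \<le> card (component F (flip i v))}"
    proof (intro subsetI CollectI conjI)
      fix i assume i: "i \<in> {i \<in> {..<g}. Q i F}"
      then show "i < d" using dx(5) by simp
      then have "finite (component F (flip i v))" using F(1) v by (intro finite_component[of F d]) simp_all
      then have "card (component (F \<inter> Ei i) (flip i v)) \<le> card (component F (flip i v))"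
        by (intro card_mono component_mono) auto
      then show "K \<le> card (component F (flip i v))" using i by (simp add: Q_def)
    qed
    then have "card {i \<in> {..<g}. Q i F} \<le> card {i. i < d \<and> K \<le> card (component F (flip i v))}"
      by (intro card_mono) auto
    then show "real (card {i \<in> {..<g}. Q i F}) \<le> r" using F(2) by linarith
  qed
  also have "\<dots> \<le> exp (r - (1 - \<rho>) * card {..<g} / 2)"
    using \<rho>(2) by (intro chernoff_lower[where A = Ei] p disj dep prob) auto
  finally show ?thesis by simp
qed

section \<open>Sprinkling\<close>

text \<open>For \<open>x \<in> A\<close> the star is empty, as \<open>x\<close> then counts as
  attached without any edge. Every edge of a star therefore joins a vertex outside \<open>A\<close>
  to one inside, which is what separates the gadgets below.\<close>

definition star :: "nat \<Rightarrow> nat set set \<Rightarrow> nat set \<Rightarrow> nat set set set" where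
  "star d A x = (if x \<in> A then {} else (\<lambda>j. {x, flip j x}) ` {j. j < d \<and> flip j x \<in> A})"

lemma star_subset: "x \<in> cube_vertices d \<Longrightarrow> star d A x \<subseteq> cube_edges d"
  by (auto simp: star_def)

lemma starD: "e \<in> star d A x \<Longrightarrow> x \<notin> A \<and> (\<exists>a\<in>A. e = {x, a})"
  by (auto simp: star_def split: if_splits)

definition attached :: "nat \<Rightarrow> nat set set \<Rightarrow> nat set \<Rightarrow> nat set set set \<Rightarrow> bool" where
  "attached d A x F \<longleftrightarrow> x \<in> A \<or> F \<inter> star d A x \<noteq> {}"

lemma depends_on_attached: "depends_on (star d A x) (\<lambda>F. of_bool (attached d A x F) :: real)"
  by (rule depends_onI) (simp add: attached_def Int_assoc)

lemma bprob_attached_ge: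
  assumes p: "0 \<le> p" "p \<le> 1" and x: "x \<in> cube_vertices d"
    and h: "x \<in> A \<or> h \<le> card {j. j < d \<and> flip j x \<in> A}"
  shows "1 - (1 - p) ^ h \<le> bprob (cube_edges d) p (attached d A x)"
proof (cases "x \<in> A")
  case True
  then have "bprob (cube_edges d) p (attached d A x) = bexp (cube_edges d) p (\<lambda>_. 1)"
    by (intro bexp_cong) (simp add: attached_def)
  then show ?thesis using p by (simp add: bexp_const)
next
  case False
  have "card (star d A x) = card {j. j < d \<and> flip j x \<in> A}"
    using False by (simp add: star_def) (intro card_image, auto simp: inj_on_def doubleton_eq_iff)
  then have "h \<le> card (star d A x)" using h False by simp
  then have "(1 - p) ^ card (star d A x) \<le> (1 - p) ^ h"
    using p by (intro power_decreasing) auto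
  moreover have "bprob (cube_edges d) p (attached d A x) = 1 - (1 - p) ^ card (star d A x)"
    using bprob_meets[OF finite_cube_edges star_subset[OF x], of p A] False by (simp add: attached_def)
  ultimately show ?thesis by simp
qed

lemma edge_boundaryI: "{u, w} \<in> F \<Longrightarrow> u \<in> S \<Longrightarrow> w \<notin> S \<Longrightarrow> {u, w} \<in> edge_boundary F S"
proof -
  assume a: "{u, w} \<in> F" "u \<in> S" "w \<notin> S"
  then have "{u, w} \<inter> S = {u}" by blast
  then show ?thesis using a by (simp add: edge_boundary_def)
qed

text \<open>Each gadget is an edge \<open>{x, flip i x}\<close> in a fixed direction \<open>i\<close> that leaves \<open>X\<close>,
  together with the star of \<open>x\<close> towards \<open>A\<close> and the star of \<open>flip i x\<close> towards \<open>B\<close>.\<close>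

lemma disjoint_gadgets:
  assumes "A \<subseteq> X" "B \<inter> X = {}" "\<And>x. x \<in> Z \<Longrightarrow> x \<in> X \<and> flip i x \<notin> X"
  shows "disjoint_family_on (\<lambda>x. {{x, flip i x}} \<union> star d A x \<union> star d B (flip i x)) Z"
    (is "disjoint_family_on ?G Z")
proof -
  \<comment> \<open>An edge reveals its gadget by its position relative to \<open>X\<close>: it
    crosses out of \<open>X\<close>, lies inside \<open>X\<close>, or lies outside \<open>X\<close>.
    In each case \<open>x\<close> or \<open>flip i x\<close> can be recovered, and with
    \<open>i\<close> fixed either one determines the other.\<close>
  have kind: "(e \<inter> X = {x} \<and> \<not> e \<subseteq> X) \<or> (e \<subseteq> X \<and> e - A = {x}) \<or> (e \<inter> X = {} \<and> e - B = {flip i x})"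
    if xZ: "x \<in> Z" and eG: "e \<in> ?G x" for x e
  proof -
    consider "e = {x, flip i x}" | "e \<in> star d A x" | "e \<in> star d B (flip i x)"
      using eG by blast
    then show ?thesis
    proof cases
      case 1
      then show ?thesis using assms(3)[OF xZ] by blast
    next
      case 2
      then obtain a where "x \<notin> A" "a \<in> A" "e = {x, a}" using starD by blast
      then show ?thesis using assms(1) assms(3)[OF xZ] by blast
    next
      case 3
      then obtain b where "flip i x \<notin> B" "b \<in> B" "e = {flip i x, b}" using starD by blast
      then show ?thesis using assms(2) assms(3)[OF xZ] by blast
    qed
  qed
  have eq: "x = x'" if xx': "x \<in> Z" "x' \<in> Z" and e: "e \<in> ?G x" "e \<in> ?G x'" for x x' e
  proof -
    have "{x} = {x'} \<or> {flip i x} = {flip i x'}"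
      using kind[OF xx'(1) e(1)] kind[OF xx'(2) e(2)] by (elim disjE) auto
    then show ?thesis by (metis flip_flip singleton_inject)
  qed
  show ?thesis unfolding disjoint_family_on_def using eq by (metis disjoint_iff)
qed

text \<open>The middle edge crosses out of \<open>X\<close>, one star lies inside \<open>X\<close>
  and the other outside, so the three events depend on disjoint edge sets and their probabilities
  multiply.\<close>

lemma bprob_gadget_ge:
  assumes p: "0 \<le> p" "p \<le> 1" and x: "x \<in> cube_vertices d" "i < d"
    and X: "A \<subseteq> X" "B \<inter> X = {}" "x \<in> X" "flip i x \<notin> X"
    and h: "x \<in> A \<or> h \<le> card {j. j < d \<and> flip j x \<in> A}"
      "flip i x \<in> B \<or> h \<le> card {j. j < d \<and> flip j (flip i x) \<in> B}"
  shows "p * (1 - (1 - p) ^ h)\<^sup>2 \<le> bprob (cube_edges d) p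
    (\<lambda>F. {x, flip i x} \<in> F \<and> attached d A x F \<and> attached d B (flip i x) F)"
proof -
  let ?E = "cube_edges d" and ?e = "{x, flip i x}"
  let ?a = "\<lambda>F. of_bool (attached d A x F) :: real" and ?b = "\<lambda>F. of_bool (attached d B (flip i x) F) :: real"
  have e: "?e \<notin> star d A x" "?e \<notin> star d B (flip i x)"
  proof -
    show "?e \<notin> star d A x"
    proof
      assume "?e \<in> star d A x"
      then obtain a where "x \<notin> A" "a \<in> A" "?e = {x, a}" using starD by blast
      then show False using X by (auto simp: doubleton_eq_iff)
    qed
    show "?e \<notin> star d B (flip i x)"
    proof
      assume "?e \<in> star d B (flip i x)"
      then obtain b where "b \<in> B" "?e = {flip i x, b}" using starD by blast
      then show False using X by (auto simp: doubleton_eq_iff)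
    qed
  qed
  have ab: "star d A x \<inter> star d B (flip i x) = {}"
  proof -
    have False if uA: "u \<in> star d A x" and uB: "u \<in> star d B (flip i x)" for u
    proof -
      obtain a where "a \<in> A" "u = {x, a}" using starD[OF uA] by blast
      moreover obtain b where "b \<in> B" "u = {flip i x, b}" using starD[OF uB] by blast
      ultimately show False using X by (auto simp: doubleton_eq_iff)
    qed
    then show ?thesis by blast
  qed
  have dab: "depends_on (star d A x \<union> star d B (flip i x)) (\<lambda>F. ?a F * ?b F)"
  proof (rule depends_onI)
    fix F
    have "?a (F \<inter> (star d A x \<union> star d B (flip i x))) = ?a F"
      by (rule depends_onD[OF depends_on_attached]) blast
    moreover have "?b (F \<inter> (star d A x \<union> star d B (flip i x))) = ?b F"
      by (rule depends_onD[OF depends_on_attached]) blast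
    ultimately show "?a (F \<inter> (star d A x \<union> star d B (flip i x))) * ?b (F \<inter> (star d A x \<union> star d B (flip i x)))
      = ?a F * ?b F" by presburger
  qed
  have "bprob ?E p (\<lambda>F. ?e \<in> F \<and> attached d A x F \<and> attached d B (flip i x) F)
    = bexp ?E p (\<lambda>F. of_bool (?e \<in> F) * (?a F * ?b F))"
    by (intro bexp_cong) auto
  also have "\<dots> = bprob ?E p (\<lambda>F. ?e \<in> F) * bexp ?E p (\<lambda>F. ?a F * ?b F)"
    by (rule bexp_indep[OF _ _ dab, of _ "{?e}"]) (use e in \<open>auto intro: depends_onI\<close>)
  also have "bexp ?E p (\<lambda>F. ?a F * ?b F) = bexp ?E p ?a * bexp ?E p ?b"
    by (rule bexp_indep[OF _ depends_on_attached depends_on_attached ab]) simp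
  also have "bprob ?E p (\<lambda>F. ?e \<in> F) = p" using x by (intro bprob_mem) simp_all
  finally have eq: "bprob ?E p (\<lambda>F. ?e \<in> F \<and> attached d A x F \<and> attached d B (flip i x) F)
    = p * (bexp ?E p ?a * bexp ?E p ?b)" .
  have "0 \<le> 1 - (1 - p) ^ h" using p by (simp add: power_le_one)
  then show ?thesis unfolding eq power2_eq_square
    using x h p by (intro mult_left_mono mult_mono bprob_attached_ge bexp_nonneg) auto
qed

text \<open>Isoperimetry gives at least \<open>a\<close> edges leaving a suitable \<open>X\<close>
  between \<open>A\<close> and \<open>B\<close>. After discarding those that end in a bad vertex and
  keeping the most frequent direction, \<open>a / (2 * d)\<close> disjoint gadgets remain. Open
  gadgets join \<open>A\<close> to \<open>B\<close>, so a cut with fewer than \<open>m\<close> edges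
  forces fewer than \<open>m\<close> open gadgets, and the Chernoff bound applies.\<close>

lemma sprinkled_cut:
  fixes p a m :: real and d h :: nat
  assumes p: "0 \<le> p" "p \<le> 1" and d: "0 < d"
    and AB: "A \<subseteq> cube_vertices d" "B \<subseteq> cube_vertices d" "A \<inter> B = {}" "a \<le> card A" "a \<le> card B"
    and bad: "d * card {x \<in> cube_vertices d. card {i. i < d \<and> flip i x \<in> A \<union> B} < 2 * h} \<le> a / 2"
  shows "bprob (cube_edges d) p (\<lambda>F. \<exists>S. A \<subseteq> S \<and> B \<inter> S = {} \<and> card (edge_boundary F S) < m)
    \<le> exp (m - p * (1 - (1 - p) ^ h)\<^sup>2 * a / (4 * d))"
proof -
  let ?E = "cube_edges d" and ?V = "cube_vertices d"
  define W where "W = {x \<in> ?V. card {i. i < d \<and> flip i x \<in> A \<union> B} < 2 * h}"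
  \<comment> \<open>\<open>X\<close> collects what attaches well to \<open>A\<close>; a vertex
    outside both \<open>X\<close> and \<open>W\<close> then attaches well to \<open>B\<close>,
    because at least half of its \<open>2 * h\<close> neighbours in \<open>A \<union> B\<close> are
    in \<open>B\<close>.\<close>
  define X where "X = A \<union> {x \<in> ?V - B. h \<le> card {i. i < d \<and> flip i x \<in> A}}"
  have X: "X \<subseteq> ?V" "A \<subseteq> X" "B \<inter> X = {}" using AB by (auto simp: X_def)
  have finV: "finite Y" if "Y \<subseteq> ?V" for Y using that by (rule finite_subset) simp
  have to_B: "y \<in> B \<or> h \<le> card {i. i < d \<and> flip i y \<in> B}" if y: "y \<in> ?V" "y \<notin> X" "y \<notin> W" for y
  proof (cases "y \<in> B")
    case False
    have "{i. i < d \<and> flip i y \<in> A \<union> B} = {i. i < d \<and> flip i y \<in> A} \<union> {i. i < d \<and> flip i y \<in> B}"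
      by blast
    then have "card {i. i < d \<and> flip i y \<in> A \<union> B}
      \<le> card {i. i < d \<and> flip i y \<in> A} + card {i. i < d \<and> flip i y \<in> B}"
      by (simp only: card_Un_le)
    moreover have "card {i. i < d \<and> flip i y \<in> A} < h" using y False by (simp add: X_def)
    moreover have "2 * h \<le> card {i. i < d \<and> flip i y \<in> A \<union> B}" using y by (simp add: W_def)
    ultimately show ?thesis by linarith
  qed simp
  define P where "P = {(x, i) \<in> out_pairs d X. flip i x \<notin> W}"
  have a_le: "a \<le> card (out_pairs d X)"
  proof -
    have "card A \<le> card X" using X finV by (intro card_mono) auto
    moreover have "card B \<le> 2 ^ d - card X"
    proof -
      have "card (B \<union> X) \<le> card ?V" using X AB by (intro card_mono) auto
      then show ?thesis
        using X AB finV by (simp add: card_Un_disjoint card_cube_vertices)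
    qed
    ultimately have "min (card A) (card B) \<le> card (out_pairs d X)"
      using card_out_pairs_ge_min[OF X(1)] by linarith
    then have "min (real (card A)) (real (card B)) \<le> real (card (out_pairs d X))"
      by (simp only: of_nat_min[symmetric] of_nat_le_iff)
    then show ?thesis using AB(4,5) by linarith
  qed
  have P_le: "card (out_pairs d X) \<le> card P + d * card W"
  proof -
    have "card (out_pairs d X - P) \<le> card (W \<times> {..<d})"
    proof (rule card_inj_on_le[of "\<lambda>(x, i). (flip i x, i)"])
      show "inj_on (\<lambda>(x, i). (flip i x, i)) (out_pairs d X - P)"
        by (rule inj_onI) (metis (mono_tags, lifting) case_prod_unfold flip_flip prod.collapse prod.inject)
      show "(\<lambda>(x, i). (flip i x, i)) ` (out_pairs d X - P) \<subseteq> W \<times> {..<d}"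
        by (auto simp: P_def out_pairs_def)
      show "finite (W \<times> {..<d})" by (simp add: W_def)
    qed
    then have "card (out_pairs d X - P) \<le> d * card W"
      by (simp add: card_cartesian_product mult.commute)
    moreover have "card (out_pairs d X) \<le> card P + card (out_pairs d X - P)"
    proof -
      have "P \<union> (out_pairs d X - P) = out_pairs d X" by (auto simp: P_def)
      then show ?thesis using card_Un_le[of P "out_pairs d X - P"] by simp
    qed
    ultimately show ?thesis by linarith
  qed
  have "real (card (out_pairs d X)) \<le> real (card P + d * card W)"
    using P_le by (simp only: of_nat_le_iff)
  then have P: "a / 2 \<le> card P" using a_le bad unfolding W_def[symmetric] by simp
  \<comment> \<open>Pigeonhole over the \<open>d\<close> directions, since the gadgets are only
    known to be disjoint within one direction.\<close>
  have "\<exists>i<d. a / (2 * d) \<le> card {x. (x, i) \<in> P}"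
  proof (rule ccontr)
    assume "\<not> ?thesis"
    then have less: "card {x. (x, i) \<in> P} < a / (2 * d)" if "i \<in> {..<d}" for i
      using that by (simp add: not_le)
    have fin: "finite {x. (x, i) \<in> P}" for i
      by (rule finV) (use X in \<open>auto simp: P_def out_pairs_def\<close>)
    have "P = (\<lambda>(i, x). (x, i)) ` (SIGMA i:{..<d}. {x. (x, i) \<in> P})"
      by (force simp: P_def out_pairs_def)
    then have "card P \<le> card (SIGMA i:{..<d}. {x. (x, i) \<in> P})"
      using fin by (metis (no_types, lifting) card_image_le finite_SigmaI finite_lessThan)
    also have "\<dots> = (\<Sum>i<d. card {x. (x, i) \<in> P})" using fin by (simp add: card_SigmaI)
    finally have "real (card P) \<le> (\<Sum>i<d. real (card {x. (x, i) \<in> P}))"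
      by (simp only: of_nat_le_iff of_nat_sum[symmetric])
    also have "\<dots> < (\<Sum>i<d. a / (2 * d))"
      using d less by (intro sum_strict_mono) auto
    also have "\<dots> = a / 2" using d by simp
    finally show False using P by simp
  qed
  then obtain i where i: "i < d" "a / (2 * d) \<le> card {x. (x, i) \<in> P}" by blast
  define Z where "Z = {x. (x, i) \<in> P}"
  have Z: "x \<in> X" "flip i x \<notin> X" "x \<in> ?V" "flip i x \<in> ?V" "flip i x \<notin> W" if "x \<in> Z" for x
    using that X i(1) by (auto simp: Z_def P_def out_pairs_def)
  have finZ: "finite Z" using Z(3) by (intro finV) blast
  define opn where "opn x F \<longleftrightarrow> {x, flip i x} \<in> F \<and> attached d A x F \<and> attached d B (flip i x) F" for x F
  define G where "G x = {{x, flip i x}} \<union> star d A x \<union> star d B (flip i x)" for x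
  have disj: "disjoint_family_on G Z"
    unfolding G_def using Z by (intro disjoint_gadgets[OF X(2,3)]) blast
  have dep: "depends_on (G x) (opn x)" for x
    by (rule depends_onI) (auto simp: opn_def attached_def G_def)
  have to_A: "x \<in> A \<or> h \<le> card {j. j < d \<and> flip j x \<in> A}" if "x \<in> X" for x
    using that by (auto simp: X_def)
  have prob: "p * (1 - (1 - p) ^ h)\<^sup>2 \<le> bprob ?E p (opn x)" if "x \<in> Z" for x
    unfolding opn_def using Z[OF that] to_A to_B i(1)
    by (intro bprob_gadget_ge[OF p _ _ X(2,3)]) auto
  have cut: "card {x \<in> Z. opn x F} \<le> card (edge_boundary F S)"
    if S: "A \<subseteq> S" "B \<inter> S = {}" and F: "F \<subseteq> ?E" for F S
  proof -
    \<comment> \<open>An open gadget contains a path from \<open>A\<close> to \<open>B\<close> with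
      at most three edges; the three cases tell which of them \<open>S\<close> cuts.\<close>
    have "\<exists>e. e \<in> G x \<and> e \<in> edge_boundary F S" if x: "x \<in> Z" "opn x F" for x
    proof -
      consider "x \<notin> S" | "x \<in> S" "flip i x \<notin> S" | "flip i x \<in> S" by blast
      then show ?thesis
      proof cases
        case 1
        then obtain e where e: "e \<in> F" "e \<in> star d A x"
          using x(2) S(1) unfolding opn_def attached_def by blast
        then obtain a where "a \<in> A" "e = {x, a}" using starD by blast
        then have "e \<in> edge_boundary F S"
          using 1 S(1) e(1) edge_boundaryI[of a x F S] by (auto simp: insert_commute)
        then show ?thesis using e(2) unfolding G_def by blast
      next
        case 2
        have "{x, flip i x} \<in> F" using x(2) by (simp add: opn_def)
        then have "{x, flip i x} \<in> edge_boundary F S" using 2 by (rule edge_boundaryI)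
        then show ?thesis unfolding G_def by blast
      next
        case 3
        then obtain e where e: "e \<in> F" "e \<in> star d B (flip i x)"
          using x(2) S(2) unfolding opn_def attached_def by blast
        then obtain b where "b \<in> B" "e = {flip i x, b}" using starD by blast
        then have "e \<in> edge_boundary F S"
          using 3 S(2) e(1) edge_boundaryI[of "flip i x" b F S] by blast
        then show ?thesis using e(2) unfolding G_def by blast
      qed
    qed
    then obtain f where f: "\<And>x. x \<in> {x \<in> Z. opn x F} \<Longrightarrow> f x \<in> G x \<and> f x \<in> edge_boundary F S"
      by (metis (mono_tags, lifting) mem_Collect_eq)
    have "inj_on f {x \<in> Z. opn x F}"
    proof (rule inj_onI)
      fix x y assume xy: "x \<in> {x \<in> Z. opn x F}" "y \<in> {x \<in> Z. opn x F}" "f x = f y"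
      then have "f x \<in> G x \<inter> G y" using f[OF xy(1)] f[OF xy(2)] by simp
      then show "x = y" using disj xy(1,2) unfolding disjoint_family_on_def by blast
    qed
    moreover have "finite (edge_boundary F S)"
      using finite_subset[OF F] by (simp add: edge_boundary_def)
    ultimately show ?thesis using f by (intro card_inj_on_le[of f]) auto
  qed
  have "bprob ?E p (\<lambda>F. \<exists>S. A \<subseteq> S \<and> B \<inter> S = {} \<and> card (edge_boundary F S) < m)
    \<le> bprob ?E p (\<lambda>F. real (card {x \<in> Z. opn x F}) \<le> m)"
  proof (intro bprob_mono p)
    fix F assume F: "F \<subseteq> ?E" "\<exists>S. A \<subseteq> S \<and> B \<inter> S = {} \<and> card (edge_boundary F S) < m"
    then obtain S where S: "A \<subseteq> S" "B \<inter> S = {}" "card (edge_boundary F S) < m" by blast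
    have "real (card {x \<in> Z. opn x F}) \<le> card (edge_boundary F S)"
      using cut[OF S(1,2) F(1)] by (simp only: of_nat_le_iff)
    then show "real (card {x \<in> Z. opn x F}) \<le> m" using S(3) by linarith
  qed
  also have "\<dots> \<le> exp (m - p * (1 - (1 - p) ^ h)\<^sup>2 * card Z / 2)"
    using p prob by (intro chernoff_lower[where A = G] p finZ disj dep) auto
  also have "\<dots> \<le> exp (m - p * (1 - (1 - p) ^ h)\<^sup>2 * a / (4 * d))"
  proof -
    have "p * (1 - (1 - p) ^ h)\<^sup>2 * (a / (2 * d)) \<le> p * (1 - (1 - p) ^ h)\<^sup>2 * card Z"
      using i(2) p by (intro mult_left_mono) (auto simp: Z_def)
    then show ?thesis by (simp add: mult.commute)
  qed
  finally show ?thesis .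
qed

section \<open>Union bound over the possible cuts\<close>

definition big :: "nat \<Rightarrow> nat \<Rightarrow> nat set set set \<Rightarrow> nat set set" where
  "big d K F = {v \<in> cube_vertices d. K \<le> card (component F v)}"

definition big_components :: "nat \<Rightarrow> nat \<Rightarrow> nat set set set \<Rightarrow> nat set set set" where
  "big_components d K F = component F ` big d K F"

lemma finite_big [simp]: "finite (big d K F)"
  by (simp add: big_def)

lemma finite_big_components [simp]: "finite (big_components d K F)"
  by (simp add: big_components_def)

lemma component_subset_big:
  assumes "F \<subseteq> cube_edges d" "v \<in> big d K F"
  shows "component F v \<subseteq> big d K F"
proof
  fix w assume w: "w \<in> component F v"
  have "v \<in> cube_vertices d" using assms(2) by (simp add: big_def)
  then have "w \<in> cube_vertices d" using w component_subset_cube[OF assms(1)] by blast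
  then show "w \<in> big d K F" using assms(2) component_eqI[OF w] by (simp add: big_def)
qed

text \<open>Big components are disjoint and have at least \<open>K\<close> vertices each. This makes
  the number of unions of big components at most 2 to the power \<open>2 ^ d / K\<close>.\<close>

lemma card_big_components_le:
  assumes "F \<subseteq> cube_edges d"
  shows "card (big_components d K F) * K \<le> 2 ^ d"
proof -
  have "(\<Sum>C\<in>big_components d K F. K) \<le> (\<Sum>C\<in>big_components d K F. card C)"
    by (rule sum_mono) (auto simp: big_components_def big_def)
  then have "card (big_components d K F) * K \<le> (\<Sum>C\<in>big_components d K F. card C)" by simp
  also have "\<dots> = card (\<Union>(big_components d K F))"
  proof (rule card_Union_disjoint[symmetric])
    show "disjoint (big_components d K F)"
      unfolding disjoint_def big_components_def using component_eqI by blast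
    fix C assume "C \<in> big_components d K F"
    then show "finite C"
      using component_subset_big[OF assms] finite_subset[OF _ finite_big]
      by (metis big_components_def imageE)
  qed
  also have "\<dots> \<le> card (cube_vertices d)"
  proof (rule card_mono)
    show "\<Union>(big_components d K F) \<subseteq> cube_vertices d"
      using component_subset_big[OF assms] unfolding big_components_def by (auto simp: big_def)
  qed simp
  finally show ?thesis by (simp add: card_cube_vertices)
qed

section \<open>Deleting a cut from the first round\<close>

text \<open>A vertex that stops being big lies in a component of \<open>F - M\<close> with fewer
  than \<open>K\<close> vertices that contains an endpoint of a deleted edge. There are at most
  \<open>2 * card M\<close> such endpoints.\<close>

lemma card_big_diff_le:
  assumes F: "F \<subseteq> cube_edges d" and M: "M \<subseteq> F"
  shows "card (big d K F - big d K (F - M)) \<le> 2 * card M * K"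
proof -
  let ?F' = "F - M"
  have F': "?F' \<subseteq> cube_edges d" using F by blast
  have finM: "finite M" by (rule finite_subset[of _ "cube_edges d"]) (use F M in auto)
  define U where "U = {u \<in> \<Union>M. card (component ?F' u) < K}"
  have "big d K F - big d K ?F' \<subseteq> (\<Union>u\<in>U. component ?F' u)"
  proof
    fix v assume v: "v \<in> big d K F - big d K ?F'"
    let ?C = "component ?F' v"
    have vV: "v \<in> cube_vertices d" using v by (simp add: big_def)
    have C: "card ?C < K" "K \<le> card (component F v)" using v by (auto simp: big_def)
    have "edge_boundary F ?C \<noteq> {}"
    proof
      assume "edge_boundary F ?C = {}"
      then have "component F v \<subseteq> ?C" by (intro component_least) simp_all
      then have "card (component F v) \<le> card ?C"
        by (intro card_mono finite_component[OF F' vV])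
      then show False using C by simp
    qed
    then obtain e where e: "e \<in> edge_boundary F ?C" by blast
    then have "e \<in> F" by (simp add: edge_boundary_def)
    have "e \<notin> ?F'"
      using e edge_boundary_component[OF F', of v] by (auto simp: edge_boundary_def)
    then have eM: "e \<in> M" using \<open>e \<in> F\<close> by blast
    obtain u where u: "u \<in> ?C" "u \<in> e"
      using e unfolding edge_boundary_iff[OF F] by blast
    have "component ?F' u = ?C" by (rule component_eqI[OF u(1)])
    then have "u \<in> U" using u eM C by (auto simp: U_def)
    moreover have "v \<in> component ?F' u" using u(1) component_sym by blast
    ultimately show "v \<in> (\<Union>u\<in>U. component ?F' u)" by blast
  qed
  moreover have edge2: "e \<subseteq> cube_vertices d \<and> finite e \<and> card e \<le> 2" if eM: "e \<in> M" for e
  proof -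
    have "e \<in> cube_edges d" using eM M F by blast
    then obtain x i where "e = {x, flip i x}" "x \<in> cube_vertices d" "i < d" by (rule cube_edge_cases)
    then show ?thesis by (simp add: card_insert_if)
  qed
  have finUM: "finite (\<Union>M)" using finM edge2 by blast
  have finU: "finite U" by (rule finite_subset[OF _ finUM]) (auto simp: U_def)
  have "finite (\<Union>u\<in>U. component ?F' u)"
    using finU edge2 finite_component[OF F'] by (auto simp: U_def)
  ultimately have "card (big d K F - big d K ?F') \<le> card (\<Union>u\<in>U. component ?F' u)"
    by (intro card_mono)
  also have "\<dots> \<le> (\<Sum>u\<in>U. card (component ?F' u))" by (rule card_UN_le[OF finU])
  also have "\<dots> \<le> (\<Sum>u\<in>U. K)" by (intro sum_mono) (simp add: U_def)
  also have "\<dots> \<le> card (\<Union>M) * K"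
    using card_mono[OF finUM, of U] by (auto simp: U_def)
  also have "\<dots> \<le> (2 * card M) * K"
  proof (rule mult_right_mono)
    have "card (\<Union>M) \<le> (\<Sum>e\<in>M. card e)" by (rule card_Union_le_sum_card)
    also have "\<dots> \<le> (\<Sum>e\<in>M. 2)" using edge2 by (intro sum_mono) blast
    finally show "card (\<Union>M) \<le> 2 * card M" by simp
  qed simp
  finally show ?thesis .
qed

text \<open>A set without boundary edges is a union of components, so the subfamily of big
  components inside \<open>S\<close> determines how \<open>S\<close> divides the big
  vertices.\<close>

lemma big_components_split:
  assumes F: "F \<subseteq> cube_edges d" and S: "edge_boundary F S = {}"
  shows "\<Union>{C \<in> big_components d K F. C \<subseteq> S} = big d K F \<inter> S"
    and "\<Union>(big_components d K F - {C \<in> big_components d K F. C \<subseteq> S}) = big d K F - S"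
proof -
  have sub: "component F v \<subseteq> S" if "v \<in> S" for v using that S by (rule component_least)
  have in_S: "v \<in> S" if "w \<in> component F v" "w \<in> S" for v w
  proof -
    have "v \<in> component F w" using that(1) component_sym by blast
    then show ?thesis using sub[OF that(2)] by blast
  qed
  show "\<Union>{C \<in> big_components d K F. C \<subseteq> S} = big d K F \<inter> S"
  proof (intro equalityI subsetI)
    fix w assume "w \<in> \<Union>{C \<in> big_components d K F. C \<subseteq> S}"
    then obtain v where "v \<in> big d K F" "w \<in> component F v" "component F v \<subseteq> S"
      by (auto simp: big_components_def)
    then show "w \<in> big d K F \<inter> S" using component_subset_big[OF F] by blast
  next
    fix w assume w: "w \<in> big d K F \<inter> S"
    then have "component F w \<in> {C \<in> big_components d K F. C \<subseteq> S}"
      using sub by (auto simp: big_components_def)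
    then show "w \<in> \<Union>{C \<in> big_components d K F. C \<subseteq> S}" using component_refl by blast
  qed
  show "\<Union>(big_components d K F - {C \<in> big_components d K F. C \<subseteq> S}) = big d K F - S"
  proof (intro equalityI subsetI)
    fix w assume "w \<in> \<Union>(big_components d K F - {C \<in> big_components d K F. C \<subseteq> S})"
    then obtain v where v: "v \<in> big d K F" "w \<in> component F v" "\<not> component F v \<subseteq> S"
      by (auto simp: big_components_def)
    then have "w \<notin> S" using in_S sub by blast
    then show "w \<in> big d K F - S" using v component_subset_big[OF F] by blast
  next
    fix w assume w: "w \<in> big d K F - S"
    then have "\<not> component F w \<subseteq> S" using component_refl by blast
    then have "component F w \<in> big_components d K F - {C \<in> big_components d K F. C \<subseteq> S}"
      using w by (auto simp: big_components_def)
    then show "w \<in> \<Union>(big_components d K F - {C \<in> big_components d K F. C \<subseteq> S})"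
      using component_refl by blast
  qed
qed

text \<open>A vertex of \<open>L\<close> has at least \<open>k\<close> vertices in its component of
  \<open>F1 \<union> F2\<close>. So it is big in \<open>F'\<close>, or it jumped past
  \<open>k\<close> in the second round, or it lost its bigness with the deleted cut. The last two
  sets have at most \<open>a / 2\<close> vertices each. This is applied to both \<open>S\<close> and
  \<open>L - S\<close>, which each have at least \<open>2 * a\<close> vertices.\<close>

lemma sparse_cut_big_parts:
  fixes m a :: real and k K d :: nat
  assumes F: "F1 \<subseteq> cube_edges d" "F2 \<subseteq> cube_edges d"
    and L: "L \<in> components d (F1 \<union> F2)" and S: "S \<subseteq> L" "2 * a \<le> card S" "card S \<le> card L / 2"
    and cut: "card (edge_boundary (F1 \<union> F2) S) < m" and k: "k \<le> 2 * a"
    and jump: "card {v \<in> cube_vertices d. k \<le> card (component (F1 \<union> F2) v) \<and> card (component F1 v) < K} \<le> a / 2"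
    and mK: "2 * m * K \<le> a / 2"
  defines "F' \<equiv> F1 - edge_boundary F1 S"
  shows "a \<le> card (big d K F' \<inter> S)" "a \<le> card (big d K F' - S)"
proof -
  let ?F = "F1 \<union> F2" and ?V = "cube_vertices d"
  let ?M = "edge_boundary F1 S"
  have F12: "?F \<subseteq> cube_edges d" using F by blast
  obtain w where w: "w \<in> ?V" "L = component ?F w" using L by (auto simp: components_def)
  have finL: "finite L" unfolding w(2) by (rule finite_component[OF F12 w(1)])
  have LV: "L \<subseteq> ?V" unfolding w(2) by (rule component_subset_cube[OF F12 w(1)])
  define J where "J = {v \<in> ?V. k \<le> card (component ?F v) \<and> card (component F1 v) < K}"
  define D where "D = big d K F1 - big d K F'"
  have M: "?M \<subseteq> F1" by (auto simp: edge_boundary_def)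
  have "finite (edge_boundary ?F S)" using finite_subset[OF F12] by (simp add: edge_boundary_def)
  then have "card ?M \<le> card (edge_boundary ?F S)"
    by (rule card_mono) (auto simp: edge_boundary_def)
  then have Mm: "card ?M \<le> m" using cut by simp
  have "card D \<le> 2 * card ?M * K" unfolding D_def F'_def by (rule card_big_diff_le[OF F(1) M])
  then have "real (card D) \<le> real (2 * card ?M * K)" by (simp only: of_nat_le_iff)
  also have "\<dots> \<le> 2 * m * K" using Mm by (simp add: mult_right_mono)
  finally have D: "card D \<le> a / 2" using mK by linarith
  have "2 * real (card S) \<le> card L" using S(3) by simp
  have part: "a \<le> card (big d K F' \<inter> T)" if T: "T \<subseteq> L" "2 * a \<le> card T" for T
  proof -
    have "T \<subseteq> (big d K F' \<inter> T) \<union> J \<union> D"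
    proof
      fix v assume v: "v \<in> T"
      then have vL: "v \<in> component ?F w" using T(1) w(2) by blast
      have "component ?F v = L" using component_eqI[OF vL] w(2) by simp
      moreover have "card T \<le> card L" by (rule card_mono[OF finL T(1)])
      then have "real k \<le> real (card L)" using k T(2) by linarith
      ultimately have "k \<le> card (component ?F v)" by simp
      moreover have "v \<in> ?V" using v T(1) LV by blast
      ultimately show "v \<in> (big d K F' \<inter> T) \<union> J \<union> D"
        using v by (auto simp: J_def D_def big_def)
    qed
    then have "card T \<le> card ((big d K F' \<inter> T) \<union> J \<union> D)"
      by (intro card_mono) (auto simp: J_def D_def)
    also have "\<dots> \<le> card (big d K F' \<inter> T) + card J + card D"
      using card_Un_le[of "(big d K F' \<inter> T) \<union> J" D] card_Un_le[of "big d K F' \<inter> T" J] by linarith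
    finally have "real (card T) \<le> card (big d K F' \<inter> T) + card J + card D"
      by (simp only: of_nat_le_iff of_nat_add[symmetric])
    then show ?thesis using T(2) D jump unfolding J_def[symmetric] by linarith
  qed
  show "a \<le> card (big d K F' \<inter> S)" using S by (intro part) auto
  have "card (L - S) = card L - card S" using S(1) finL by (meson card_Diff_subset finite_subset)
  moreover have "card S \<le> card L" using S(1) finL by (rule card_mono[rotated])
  ultimately have "2 * a \<le> card (L - S)" using S(2,3) by (simp add: of_nat_diff)
  then have "a \<le> card (big d K F' \<inter> (L - S))" by (intro part) auto
  also have "card (big d K F' \<inter> (L - S)) \<le> card (big d K F' - S)"
    by (rule card_mono) auto
  finally show "a \<le> card (big d K F' - S)" by simp
qed

text \<open>A vertex falling below \<open>2 * h\<close> big neighbours either had fewer than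
  \<open>4 * h\<close> before, or lost at least \<open>2 * h\<close> of them. The latter are bounded
  by double counting pairs of such a vertex and a lost neighbour.\<close>

lemma few_bad_vertices:
  fixes d h K :: nat
  assumes F: "F \<subseteq> cube_edges d" and M: "M \<subseteq> F"
  shows "h * card {x \<in> cube_vertices d. card {i. i < d \<and> flip i x \<in> big d K (F - M)} < 2 * h}
    \<le> h * card {x \<in> cube_vertices d. card {i. i < d \<and> flip i x \<in> big d K F} < 4 * h}
      + d * (card M * K)"
proof -
  let ?V = "cube_vertices d"
  define D where "D = big d K F - big d K (F - M)"
  let ?Y = "{x \<in> ?V. 2 * h \<le> card {i. i < d \<and> flip i x \<in> D}}"
  let ?N = "{x \<in> ?V. card {i. i < d \<and> flip i x \<in> big d K F} < 4 * h}"
  have "{x \<in> ?V. card {i. i < d \<and> flip i x \<in> big d K (F - M)} < 2 * h} \<subseteq> ?N \<union> ?Y"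
  proof
    fix x assume x: "x \<in> {x \<in> ?V. card {i. i < d \<and> flip i x \<in> big d K (F - M)} < 2 * h}"
    have "card {i. i < d \<and> flip i x \<in> big d K F}
      \<le> card ({i. i < d \<and> flip i x \<in> big d K (F - M)} \<union> {i. i < d \<and> flip i x \<in> D})"
      by (rule card_mono) (auto simp: D_def)
    also have "\<dots> \<le> card {i. i < d \<and> flip i x \<in> big d K (F - M)} + card {i. i < d \<and> flip i x \<in> D}"
      by (rule card_Un_le)
    finally show "x \<in> ?N \<union> ?Y" using x by auto
  qed
  then have "card {x \<in> ?V. card {i. i < d \<and> flip i x \<in> big d K (F - M)} < 2 * h} \<le> card (?N \<union> ?Y)"
    by (intro card_mono) auto
  also have "\<dots> \<le> card ?N + card ?Y" by (rule card_Un_le)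
  finally have 1: "card {x \<in> ?V. card {i. i < d \<and> flip i x \<in> big d K (F - M)} < 2 * h}
    \<le> card ?N + card ?Y" .
  have "2 * h * card ?Y \<le> (\<Sum>x\<in>?Y. card {i. i < d \<and> flip i x \<in> D})"
    using sum_mono[of ?Y "\<lambda>_. 2 * h" "\<lambda>x. card {i. i < d \<and> flip i x \<in> D}"] by (simp add: mult.commute)
  also have "\<dots> = card (SIGMA x:?Y. {i. i < d \<and> flip i x \<in> D})" by (simp add: card_SigmaI)
  also have "\<dots> \<le> card (D \<times> {..<d})"
  proof (rule card_inj_on_le[of "\<lambda>(x, i). (flip i x, i)"])
    show "inj_on (\<lambda>(x, i). (flip i x, i)) (SIGMA x:?Y. {i. i < d \<and> flip i x \<in> D})"
      by (rule inj_onI) (metis (mono_tags, lifting) case_prod_unfold flip_flip prod.collapse prod.inject)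
  qed (auto simp: D_def)
  also have "\<dots> = card D * d" by (simp add: card_cartesian_product)
  also have "\<dots> \<le> 2 * card M * K * d"
    unfolding D_def by (rule mult_right_mono[OF card_big_diff_le[OF F M]]) simp
  finally have "h * card ?Y \<le> d * (card M * K)" by (simp add: mult_ac)
  moreover have "h * card {x \<in> ?V. card {i. i < d \<and> flip i x \<in> big d K (F - M)} < 2 * h}
    \<le> h * (card ?N + card ?Y)" using 1 by (rule mult_left_mono) simp
  ultimately show ?thesis by (simp add: distrib_left)
qed

section \<open>Summation over the patterns of a cut\<close>

text \<open>With \<open>F1\<close> fixed, a sparse cut \<open>S\<close> leaves a pattern: its
  boundary \<open>M\<close> in \<open>F1\<close> and the big components of \<open>F1 - M\<close>
  inside \<open>S\<close>. For a given pattern \<open>sprinkled_cut\<close> treats all such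
  \<open>S\<close> at once, so only patterns are counted. Few edges in \<open>M\<close> and few big
  components keep their number small.\<close>

lemma bprob_sparse_cut_le:
  fixes m a y p :: real and k K d h :: nat
  assumes p: "0 \<le> p" "p \<le> 1" and y: "0 < y" "y \<le> 1"
    and pos: "0 < d" "0 < h" "0 < K" and k: "k \<le> 2 * a" and mK: "2 * m * K \<le> a / 2"
    and F1: "F1 \<subseteq> cube_edges d"
    and good: "d * (card {x \<in> cube_vertices d. card {i. i < d \<and> flip i x \<in> big d K F1} < 4 * h}
      + d * m * K / h) \<le> a / 2"
  shows "bprob (cube_edges d) p (\<lambda>F2.
      card {v \<in> cube_vertices d. k \<le> card (component (F1 \<union> F2) v) \<and> card (component F1 v) < K} \<le> a / 2 \<and>
      (\<exists>L S. L \<in> components d (F1 \<union> F2) \<and> S \<subseteq> L \<and> 2 * a \<le> card S \<and> card S \<le> card L / 2 \<and>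
        card (edge_boundary (F1 \<union> F2) S) < m))
    \<le> exp (y * (2 ^ d * d) - m * ln y + ln 2 * 2 ^ d / K + m - p * (1 - (1 - p) ^ h)\<^sup>2 * a / (4 * d))"
proof -
  let ?E = "cube_edges d"
  let ?C = "\<lambda>M. big_components d K (F1 - M)"
  let ?sep = "\<lambda>A B F. \<exists>S. A \<subseteq> S \<and> B \<inter> S = {} \<and> card (edge_boundary F S) < m"
  define b where "b = exp (m - p * (1 - (1 - p) ^ h)\<^sup>2 * a / (4 * d))"
  define \<M> where "\<M> = {M. M \<subseteq> F1 \<and> card M \<le> m}"
  define I where "I = (SIGMA M:\<M>. Pow (?C M))"
  \<comment> \<open>Only patterns meeting the size and disjointness conditions of
    \<open>sprinkled_cut\<close> enter the sum.\<close>
  define J where "J = {(M, \<A>) \<in> I. a \<le> card (\<Union>\<A>) \<and> a \<le> card (\<Union>(?C M - \<A>)) \<and> \<Union>\<A> \<inter> \<Union>(?C M - \<A>) = {}}"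
  have finF1: "finite F1" by (rule finite_subset[OF F1]) simp
  have fin\<M>: "finite \<M>" by (rule finite_subset[of _ "Pow F1"]) (use finF1 in \<open>auto simp: \<M>_def\<close>)
  have finI: "finite I" unfolding I_def using fin\<M> by (intro finite_SigmaI) auto
  have JI: "J \<subseteq> I" by (auto simp: J_def)
  have finJ: "finite J" by (rule finite_subset[OF JI finI])
  have sep: "bprob ?E p (?sep (\<Union>\<A>) (\<Union>(?C M - \<A>))) \<le> b" if MA: "(M, \<A>) \<in> J" for M \<A>
    unfolding b_def
  proof (rule sprinkled_cut[OF p pos(1)])
    have M: "M \<subseteq> F1" "card M \<le> m" "\<A> \<subseteq> ?C M" using MA by (auto simp: J_def I_def \<M>_def)
    have F': "F1 - M \<subseteq> ?E" using F1 by blast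
    have C: "\<Union>(?C M) = big d K (F1 - M)"
      using component_subset_big[OF F'] component_refl unfolding big_components_def by blast
    have AB: "\<Union>\<A> \<union> \<Union>(?C M - \<A>) = big d K (F1 - M)" unfolding C[symmetric] using M(3) by blast
    have "big d K (F1 - M) \<subseteq> cube_vertices d" by (auto simp: big_def)
    then show "\<Union>\<A> \<subseteq> cube_vertices d" "\<Union>(?C M - \<A>) \<subseteq> cube_vertices d" using AB by blast+
    show "\<Union>\<A> \<inter> \<Union>(?C M - \<A>) = {}" "a \<le> card (\<Union>\<A>)" "a \<le> card (\<Union>(?C M - \<A>))"
      using MA by (auto simp: J_def)
    let ?W = "{x \<in> cube_vertices d. card {i. i < d \<and> flip i x \<in> \<Union>\<A> \<union> \<Union>(?C M - \<A>)} < 2 * h}"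
    let ?N = "{x \<in> cube_vertices d. card {i. i < d \<and> flip i x \<in> big d K F1} < 4 * h}"
    have "h * card ?W \<le> h * card ?N + d * (card M * K)"
      unfolding AB by (rule few_bad_vertices[OF F1 M(1)])
    then have "real (h * card ?W) \<le> real (h * card ?N + d * (card M * K))" by (simp only: of_nat_le_iff)
    also have "\<dots> \<le> h * (card ?N + d * m * K / h)"
    proof -
      have "real d * (real (card M) * K) \<le> d * (m * K)" using M(2) by (intro mult_left_mono mult_right_mono) auto
      then show ?thesis using pos by (simp add: distrib_left mult_ac)
    qed
    finally have "h * card ?W \<le> h * (card ?N + d * m * K / h)" .
    then have "card ?W \<le> card ?N + d * m * K / h" using pos(2) by simp
    then have "d * card ?W \<le> d * (card ?N + d * m * K / h)" by (simp add: mult_left_mono)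
    then show "real (d * card ?W) \<le> a / 2" using good by (rule order_trans)
  qed
  have "bprob ?E p (\<lambda>F2.
      card {v \<in> cube_vertices d. k \<le> card (component (F1 \<union> F2) v) \<and> card (component F1 v) < K} \<le> a / 2 \<and>
      (\<exists>L S. L \<in> components d (F1 \<union> F2) \<and> S \<subseteq> L \<and> 2 * a \<le> card S \<and> card S \<le> card L / 2 \<and>
        card (edge_boundary (F1 \<union> F2) S) < m))
    \<le> (\<Sum>(M, \<A>)\<in>J. bprob ?E p (?sep (\<Union>\<A>) (\<Union>(?C M - \<A>))))"
    unfolding split_def
  proof (rule bprob_union_bound[OF p finJ])
    fix F2 assume F2: "F2 \<subseteq> ?E"
    assume ass: "card {v \<in> cube_vertices d. k \<le> card (component (F1 \<union> F2) v) \<and> card (component F1 v) < K} \<le> a / 2 \<and>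
      (\<exists>L S. L \<in> components d (F1 \<union> F2) \<and> S \<subseteq> L \<and> 2 * a \<le> card S \<and> card S \<le> card L / 2 \<and>
        card (edge_boundary (F1 \<union> F2) S) < m)"
    then obtain L S where L: "L \<in> components d (F1 \<union> F2)" "S \<subseteq> L" "2 * a \<le> card S" "card S \<le> card L / 2"
        "card (edge_boundary (F1 \<union> F2) S) < m" by blast
    define M where "M = edge_boundary F1 S"
    define \<A> where "\<A> = {C \<in> ?C M. C \<subseteq> S}"
    have F': "F1 - M \<subseteq> ?E" using F1 by blast
    have closed: "edge_boundary (F1 - M) S = {}" by (auto simp: M_def edge_boundary_def)
    note split = big_components_split[OF F' closed, of K, folded \<A>_def]
    have fin: "finite (edge_boundary (F1 \<union> F2) S)"
      using finF1 finite_subset[OF F2] by (simp add: edge_boundary_def)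
    have "card M \<le> card (edge_boundary (F1 \<union> F2) S)"
      unfolding M_def by (rule card_mono[OF fin]) (auto simp: edge_boundary_def)
    then have "card M \<le> m" using L(5) by simp
    moreover have "M \<subseteq> F1" by (auto simp: M_def edge_boundary_def)
    ultimately have "(M, \<A>) \<in> I" by (auto simp: I_def \<M>_def \<A>_def)
    moreover have "a \<le> card (\<Union>\<A>)" "a \<le> card (\<Union>(?C M - \<A>))"
      unfolding split unfolding M_def
      using sparse_cut_big_parts[OF F1 F2 L k conjunct1[OF ass] mK] by simp_all
    moreover have "\<Union>\<A> \<inter> \<Union>(?C M - \<A>) = {}" unfolding split by blast
    ultimately have "(M, \<A>) \<in> J" by (simp add: J_def)
    moreover have "?sep (\<Union>\<A>) (\<Union>(?C M - \<A>)) F2"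
    proof (intro exI conjI)
      show "\<Union>\<A> \<subseteq> S" "\<Union>(?C M - \<A>) \<inter> S = {}" unfolding split by blast+
      have "card (edge_boundary F2 S) \<le> card (edge_boundary (F1 \<union> F2) S)"
        by (rule card_mono[OF fin]) (auto simp: edge_boundary_def)
      then show "card (edge_boundary F2 S) < m" using L(5) by simp
    qed
    ultimately show "\<exists>MA\<in>J. ?sep (\<Union>(snd MA)) (\<Union>(?C (fst MA) - snd MA)) F2"
      by (intro bexI[of _ "(M, \<A>)"]) simp_all
  qed
  also have "\<dots> \<le> (\<Sum>MA\<in>J. b)" using sep by (intro sum_mono) auto
  also have "\<dots> \<le> card I * b"
    using card_mono[OF finI JI] by (simp add: b_def)
  also have "card I \<le> exp (y * (2 ^ d * d) - m * ln y) * exp (ln 2 * 2 ^ d / K)"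
  proof -
    have C_le: "2 ^ card (?C M) \<le> exp (ln 2 * 2 ^ d / K)" for M
    proof -
      have "card (?C M) * K \<le> 2 ^ d" by (rule card_big_components_le) (use F1 in blast)
      then have "real (card (?C M) * K) \<le> real (2 ^ d)" by (simp only: of_nat_le_iff)
      then have "real (card (?C M)) \<le> 2 ^ d / K" using pos(3) by (simp add: field_simps)
      then have "ln 2 * real (card (?C M)) \<le> ln 2 * (2 ^ d / K)" by (intro mult_left_mono) auto
      then have "exp (card (?C M) * ln 2) \<le> exp (ln 2 * 2 ^ d / K)" by (simp add: mult.commute)
      then show ?thesis by (simp add: exp_of_nat_mult)
    qed
    have "real (card I) = (\<Sum>M\<in>\<M>. 2 ^ card (?C M))"
      unfolding I_def using fin\<M> by (simp add: card_SigmaI card_Pow)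
    also have "\<dots> \<le> card \<M> * exp (ln 2 * 2 ^ d / K)"
      using sum_mono[of \<M> "\<lambda>M. 2 ^ card (?C M)" "\<lambda>_. exp (ln 2 * 2 ^ d / K)"] C_le by simp
    also have "card \<M> \<le> exp (y * card F1 - m * ln y)"
      unfolding \<M>_def by (rule card_small_subsets_le[OF finF1 y])
    also have "\<dots> \<le> exp (y * (2 ^ d * d) - m * ln y)"
    proof -
      have "card F1 \<le> card ?E" using F1 by (intro card_mono) auto
      then have "real (card F1) \<le> real (2 ^ d * d)"
        using card_cube_edges_le[of d] by (simp only: of_nat_le_iff)
      then have "y * card F1 \<le> y * (2 ^ d * d)" using y by (intro mult_left_mono) auto
      then show ?thesis by simp
    qed
    finally show ?thesis by simp
  qed
  finally show ?thesis
    by (simp add: b_def mult_right_mono algebra_simps flip: exp_add)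
qed

section \<open>The limit\<close>

text \<open>The failure event, with \<open>L\<close> ranging over all components and not only the
  largest, so that no information about the size of the largest component is called for.\<close>

definition sparse_cut :: "nat \<Rightarrow> real \<Rightarrow> real \<Rightarrow> nat set set set \<Rightarrow> bool" where
  "sparse_cut d s m F \<longleftrightarrow> (\<exists>L S. L \<in> components d F \<and> S \<subseteq> L \<and> s \<le> real (card S) \<and>
     real (card S) \<le> real (card L) / 2 \<and> real (card (edge_boundary F S)) < m)"

text \<open>The three summands are the three ways to fail: at least \<open>t\<close> vertices have
  few big neighbours in the first round, at least \<open>a / 2\<close> vertices jump to size
  \<open>k\<close> from a component smaller than \<open>K\<close>, or a sparse cut survives although
  neither happened.\<close>

lemma bprob_sparse_cut_sprinkled:
  fixes x \<rho> p p1 p2 a m t y :: real and d g h k l K :: nat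
  assumes dx: "2 \<le> d" "0 \<le> x" "1 + x \<le> d" "l \<le> d - g" "g \<le> d"
    and \<rho>: "(1 + x) * exp (2 * l / d - x / d * (d - g - l)) \<le> \<rho>" "\<rho> \<le> 1"
    and K: "K \<le> 2 ^ l" "0 < K" and p1: "p1 = (1 + x) / d"
    and p: "1 - p = (1 - p1) * (1 - p2)" and p2: "0 \<le> p2" "p2 \<le> 1"
    and pos: "0 < a" "0 < t" "0 < h" and y: "0 < y" "y \<le> 1"
    and k: "k \<le> 2 * a" and mK: "0 \<le> m" "2 * m * K \<le> a / 2"
    and good: "d * (t + d * m * K / h) \<le> a / 2"
  shows "bprob (cube_edges d) p (sparse_cut d (2 * a) m)
    \<le> 2 ^ d * exp (4 * h - (1 - \<rho>) * g / 2) / t + 2 ^ d * (\<rho> ^ k + k * d * p2) / (a / 2)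
      + exp (y * (2 ^ d * d) - m * ln y + ln 2 * 2 ^ d / K + m
          - p2 * (1 - (1 - p2) ^ h)\<^sup>2 * a / (4 * d))"
proof -
  let ?E = "cube_edges d" and ?V = "cube_vertices d"
  have p1': "0 \<le> p1" "p1 \<le> 1" using dx by (auto simp: p1)
  define few where "few F x \<longleftrightarrow> real (card {i. i < d \<and> K \<le> card (component F (flip i x))}) \<le> 4 * h"
    for F x
  define J where "J F1 F2 = {v \<in> ?V. k \<le> card (component (F1 \<union> F2) v) \<and> card (component F1 v) < K}"
    for F1 F2
  define b where "b = exp (y * (2 ^ d * d) - m * ln y + ln 2 * 2 ^ d / K + m
      - p2 * (1 - (1 - p2) ^ h)\<^sup>2 * a / (4 * d))"
  have "bprob ?E p (sparse_cut d (2 * a) m)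
    = bexp ?E p1 (\<lambda>F1. bprob ?E p2 (\<lambda>F2. sparse_cut d (2 * a) m (F1 \<union> F2)))"
    by (rule bexp_sprinkle[OF _ p]) simp
  \<comment> \<open>A first round with too many vertices having few big neighbours is charged
    probability 1; for any other the union bound over patterns gives \<open>b\<close>.\<close>
  also have "\<dots> \<le> bexp ?E p1 (\<lambda>F1. of_bool (t \<le> real (card {x \<in> ?V. few F1 x}))
      + (bprob ?E p2 (\<lambda>F2. a / 2 \<le> real (card (J F1 F2))) + b))"
  proof (intro bexp_mono p1')
    fix F1 assume F1: "F1 \<subseteq> ?E"
    let ?jump = "\<lambda>F2. a / 2 \<le> real (card (J F1 F2))"
    let ?cut = "\<lambda>F2. sparse_cut d (2 * a) m (F1 \<union> F2)"
    have jump0: "0 \<le> bprob ?E p2 ?jump" by (intro bexp_nonneg p2) simp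
    show "bprob ?E p2 ?cut \<le> of_bool (t \<le> real (card {x \<in> ?V. few F1 x})) + (bprob ?E p2 ?jump + b)"
    proof (cases "t \<le> real (card {x \<in> ?V. few F1 x})")
      case True
      have "bprob ?E p2 ?cut \<le> 1" by (intro bprob_le_1 p2) simp
      moreover have "0 < b" by (simp add: b_def)
      ultimately show ?thesis using True jump0 by simp
    next
      case False
      have "{x \<in> ?V. card {i. i < d \<and> flip i x \<in> big d K F1} < 4 * h} \<subseteq> {x \<in> ?V. few F1 x}"
      proof
        fix x assume x: "x \<in> {x \<in> ?V. card {i. i < d \<and> flip i x \<in> big d K F1} < 4 * h}"
        then have "{i. i < d \<and> flip i x \<in> big d K F1} = {i. i < d \<and> K \<le> card (component F1 (flip i x))}"
          by (auto simp: big_def)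
        then show "x \<in> {x \<in> ?V. few F1 x}" using x by (simp add: few_def)
      qed
      then have "card {x \<in> ?V. card {i. i < d \<and> flip i x \<in> big d K F1} < 4 * h} \<le> card {x \<in> ?V. few F1 x}"
        by (intro card_mono) auto
      then have "real (card {x \<in> ?V. card {i. i < d \<and> flip i x \<in> big d K F1} < 4 * h}) \<le> t"
        using False by linarith
      then have "d * (card {x \<in> ?V. card {i. i < d \<and> flip i x \<in> big d K F1} < 4 * h} + d * m * K / h)
        \<le> d * (t + d * m * K / h)" by (intro mult_left_mono add_right_mono) auto
      also note good
      finally have "bprob ?E p2 (\<lambda>F2. card (J F1 F2) \<le> a / 2 \<and> ?cut F2) \<le> b"
        unfolding b_def J_def sparse_cut_def using dx
        by (intro bprob_sparse_cut_le p2 y pos(3) K(2) k mK F1) simp_all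
      moreover have "bprob ?E p2 ?cut
        \<le> bexp ?E p2 (\<lambda>F2. of_bool (?jump F2) + of_bool (card (J F1 F2) \<le> a / 2 \<and> ?cut F2))"
        by (intro bexp_mono p2) auto
      ultimately show ?thesis using False by (simp add: bexp_add)
    qed
  qed
  also have "\<dots> = bprob ?E p1 (\<lambda>F1. t \<le> real (card {x \<in> ?V. few F1 x}))
      + (bexp ?E p1 (\<lambda>F1. bprob ?E p2 (\<lambda>F2. a / 2 \<le> real (card (J F1 F2)))) + b)"
    by (simp only: bexp_add bexp_const[OF finite_cube_edges])
  also have "\<dots> \<le> 2 ^ d * exp (4 * h - (1 - \<rho>) * g / 2) / t
      + (2 ^ d * (\<rho> ^ k + k * d * p2) / (a / 2) + b)"
  proof (intro add_mono order_refl)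
    have "bprob ?E p1 (\<lambda>F1. t \<le> real (card {x \<in> ?V. few F1 x}))
      \<le> (\<Sum>v\<in>?V. bprob ?E p1 (\<lambda>F1. few F1 v)) / t"
      by (intro markov_count p1' pos) simp
    also have "\<dots> \<le> (\<Sum>v\<in>?V. exp (4 * h - (1 - \<rho>) * g / 2)) / t"
      using pos unfolding few_def p1
      by (intro divide_right_mono sum_mono bprob_few_big_neighbours[OF dx \<rho> K(1)]) auto
    finally show "bprob ?E p1 (\<lambda>F1. t \<le> real (card {x \<in> ?V. few F1 x}))
      \<le> 2 ^ d * exp (4 * h - (1 - \<rho>) * g / 2) / t" by (simp add: card_cube_vertices)
    \<comment> \<open>The rate assumed for subcubes of dimension \<open>d - g\<close> also serves
      the full cube, where each vertex has more boundary.\<close>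
    have "(1 + x) * exp (2 * l / d - x / d * (d - l)) \<le> (1 + x) * exp (2 * l / d - x / d * (d - g - l))"
      using dx by (intro mult_left_mono) (auto intro!: mult_left_mono divide_right_mono)
    then have \<rho>': "(1 + x) * exp (2 * l / d - x / d * (d - l)) \<le> \<rho>" using \<rho>(1) by linarith
    have deg: "d \<le> card {i. i < d \<and> {u, flip i u} \<in> ?E}" if "u \<in> ?V" for u
    proof -
      have "{i. i < d \<and> {u, flip i u} \<in> ?E} = {..<d}" using that by auto
      then show ?thesis by simp
    qed
    have "l \<le> d" using dx by simp
    have "e \<subseteq> ?V" if "e \<in> ?E" for e
      using that by (auto elim!: cube_edge_cases)
    then have "bprob ?E p1 (\<lambda>F. k \<le> card (component F v) \<and> card (component F v) < K) \<le> \<rho> ^ k"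
      if "v \<in> ?V" for v
      unfolding p1 using that deg
      by (intro bprob_component_size_le[where U = ?V, OF dx(1-3) \<open>l \<le> d\<close> \<rho>' \<rho>(2) _ _ _ _ _ K(1)]) auto
    then show "bexp ?E p1 (\<lambda>F1. bprob ?E p2 (\<lambda>F2. a / 2 \<le> real (card (J F1 F2))))
      \<le> 2 ^ d * (\<rho> ^ k + k * d * p2) / (a / 2)"
      unfolding J_def using pos by (intro component_jump_count p1' p2) auto
  qed
  finally show ?thesis unfolding b_def by (simp only: add.assoc)
qed

section \<open>Choice of parameters and asymptotics\<close>

lemma nat_floor_bounds:
  fixes z :: real
  assumes "0 \<le> z"
  shows "z - 1 \<le> nat \<lfloor>z\<rfloor>" "nat \<lfloor>z\<rfloor> \<le> z"
  using assms by linarith+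

lemma nat_ceiling_bounds:
  fixes z :: real
  assumes "0 \<le> z"
  shows "z \<le> nat \<lceil>z\<rceil>" "nat \<lceil>z\<rceil> \<le> z + 1"
  using assms by linarith+

text \<open>The three failure probabilities get the shares \<open>\<eta> / 4\<close>,
  \<open>\<eta> / 2\<close> and \<open>\<eta> / 4\<close>. The first and third bounds tend to 0; the
  middle one stays constant and is made small through \<open>k\<close> and \<open>\<delta>\<close>,
  so the split of the density depends on \<open>\<eta>\<close>.\<close>

lemma eventually_sparse_cut_unlikely:
  fixes \<epsilon> \<alpha> \<eta> :: real
  assumes "0 < \<epsilon>" "0 < \<alpha>" "0 < \<eta>"
  shows "\<forall>\<^sub>F d in sequentially. bprob (cube_edges d) ((1 + \<epsilon>) / d)
    (sparse_cut d (\<alpha> * 2 ^ d) (2 ^ d / (real d ^ 3 * (ln d)\<^sup>2))) \<le> \<eta>"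
proof -
  define \<rho>0 where "\<rho>0 = (1 + \<epsilon> / 2) * exp (- (\<epsilon> / 2))"
  define \<rho> where "\<rho> = (1 + \<rho>0) / 2"
  define \<tau> where "\<tau> = ln (\<rho> / \<rho>0)"
  define \<gamma> where "\<gamma> = min (1 / 2) (\<tau> / (2 * \<epsilon>))"
  \<comment> \<open>With \<open>g\<close> about \<open>\<gamma> * d\<close>, the Chernoff gain
    \<open>(1 - \<rho>) * g / 2\<close> is about \<open>8 * \<kappa> * d\<close>, twice the loss
    \<open>4 * h\<close> for \<open>h\<close> about \<open>\<kappa> * d\<close>.\<close>
  define \<kappa> where "\<kappa> = (1 - \<rho>) * \<gamma> / 16"
  have \<rho>0: "0 < \<rho>0" "\<rho>0 < 1"
  proof -
    show "0 < \<rho>0" using assms by (simp add: \<rho>0_def)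
    have "ln (1 + \<epsilon> / 2) < \<epsilon> / 2" using assms by (intro ln_add_one_self_less_self) simp
    then have "exp (ln (1 + \<epsilon> / 2)) < exp (\<epsilon> / 2)" by simp
    then have "1 + \<epsilon> / 2 < exp (\<epsilon> / 2)" using assms by simp
    then show "\<rho>0 < 1" by (simp add: \<rho>0_def exp_minus field_simps)
  qed
  then have \<rho>: "0 < \<rho>" "\<rho> < 1" "\<rho>0 < \<rho>" by (auto simp: \<rho>_def)
  then have \<tau>: "0 < \<tau>" "\<rho>0 * exp \<tau> = \<rho>" using \<rho>0 by (auto simp: \<tau>_def)
  have \<gamma>: "0 < \<gamma>" "\<gamma> \<le> 1 / 2" "\<epsilon> * \<gamma> \<le> \<tau> / 2"
    using assms \<tau> by (auto simp: \<gamma>_def min_def field_simps)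
  have \<kappa>: "0 < \<kappa>" using \<rho> \<gamma> by (simp add: \<kappa>_def)
  obtain k where k: "\<rho> ^ k < \<alpha> * \<eta> / 16"
    using real_arch_pow_inv[of "\<alpha> * \<eta> / 16" \<rho>] \<rho> assms by auto
  define \<delta> where "\<delta> = min (\<epsilon> / 2) (\<alpha> * \<eta> / (32 * (k + 1)))"
  have \<delta>: "0 < \<delta>" "\<delta> \<le> \<epsilon> / 2" "2 * k * \<delta> \<le> \<alpha> * \<eta> / 16"
  proof -
    show "0 < \<delta>" using assms by (simp add: \<delta>_def)
    show "\<delta> \<le> \<epsilon> / 2" unfolding \<delta>_def by (rule min.cobounded1)
    have "2 * k * \<delta> \<le> 2 * (k + 1) * (\<alpha> * \<eta> / (32 * (k + 1)))"
      using \<open>0 < \<delta>\<close> by (intro mult_mono) (simp_all add: \<delta>_def)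
    also have "\<dots> = \<alpha> * \<eta> / 16" by (simp add: field_simps)
    finally show "2 * k * \<delta> \<le> \<alpha> * \<eta> / 16" .
  qed
  define x where "x = \<epsilon> - \<delta>"
  have x: "\<epsilon> / 2 \<le> x" "x \<le> \<epsilon>" "0 < x" using \<delta> assms by (auto simp: x_def)
  have x_exp: "(1 + x) * exp (- x) \<le> \<rho>0"
  proof -
    have "1 + x \<le> (1 + \<epsilon> / 2) * (1 + (x - \<epsilon> / 2))"
      using x assms by (simp add: algebra_simps)
    also have "\<dots> \<le> (1 + \<epsilon> / 2) * exp (x - \<epsilon> / 2)"
      using assms exp_ge_add_one_self by (intro mult_left_mono) auto
    finally have "(1 + x) * exp (- x) \<le> (1 + \<epsilon> / 2) * exp (x - \<epsilon> / 2) * exp (- x)"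
      by (intro mult_right_mono) auto
    also have "\<dots> = \<rho>0" by (simp add: \<rho>0_def mult.assoc flip: exp_add)
    finally show ?thesis .
  qed
  \<comment> \<open>\<open>s0\<close> bounds the attachment probability
    \<open>1 - (1 - p2) ^ h\<close> from below, as \<open>p2 * h\<close> is at least
    \<open>\<delta> * \<kappa> / 2\<close>. The constant \<open>c\<close> is half the resulting
    decay rate per \<open>2 ^ d / (real d)\<^sup>2\<close>, leaving the other half for the union
    bound.\<close>
  define s0 where "s0 = 1 - exp (- (\<delta> * \<kappa> / 2))"
  have s0: "0 < s0" using \<delta> \<kappa> by (simp add: s0_def)
  define c where "c = \<delta> * s0\<^sup>2 * \<alpha> / 16"
  have c: "0 < c" using \<delta> s0 assms by (simp add: c_def)

  \<comment> \<open>The requirements on \<open>d\<close> are collected here in the order in which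
    they become \<open>elim(1)\<close> to \<open>elim(11)\<close>.\<close>
  have "\<forall>\<^sub>F d in sequentially. 2 * (1 + \<epsilon>) + 4 \<le> real d" by real_asymp
  moreover have "\<forall>\<^sub>F d in sequentially. (real d)\<^sup>2 * ln d + 1 \<le> 2 powr (sqrt d - 1)" by real_asymp
  moreover have "\<forall>\<^sub>F d in sequentially. sqrt (real d) \<le> real d / 2" by real_asymp
  moreover have "\<forall>\<^sub>F d in sequentially. (2 + \<epsilon>) / sqrt (real d) \<le> \<tau> / 2"
  proof -
    have "((\<lambda>d::nat. (2 + \<epsilon>) / sqrt (real d)) \<longlongrightarrow> 0) sequentially" by real_asymp
    then have "\<forall>\<^sub>F d in sequentially. (2 + \<epsilon>) / sqrt (real d) < \<tau> / 2"
      using \<tau> by (intro order_tendstoD) auto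
    then show ?thesis by eventually_elim simp
  qed
  moreover have "\<forall>\<^sub>F d in sequentially. 2 \<le> \<kappa> * real d" using \<kappa> by real_asymp
  moreover have "\<forall>\<^sub>F d in sequentially. real k \<le> \<alpha> * 2 ^ d" using assms by real_asymp
  moreover have "\<forall>\<^sub>F d in sequentially.
      2 * ((real d)\<^sup>2 * ln d + 1) / (real d ^ 3 * (ln d)\<^sup>2) < \<alpha> / 4"
  proof -
    have "((\<lambda>d::nat. 2 * ((real d)\<^sup>2 * ln d + 1) / (real d ^ 3 * (ln d)\<^sup>2)) \<longlongrightarrow> 0) sequentially"
      by real_asymp
    then show ?thesis using assms by (intro order_tendstoD) auto
  qed
  moreover have "\<forall>\<^sub>F d in sequentially. real d * (1 / (real d)\<^sup>2
      + real d / (real d ^ 3 * (ln d)\<^sup>2) * ((real d)\<^sup>2 * ln d + 1) / (\<kappa> * d / 2)) < \<alpha> / 4"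
  proof -
    have "((\<lambda>d::nat. real d * (1 / (real d)\<^sup>2 + real d / (real d ^ 3 * (ln d)\<^sup>2)
        * ((real d)\<^sup>2 * ln d + 1) / (\<kappa> * d / 2))) \<longlongrightarrow> 0) sequentially"
      using \<kappa> by real_asymp
    then show ?thesis using assms by (intro order_tendstoD) auto
  qed
  moreover have "\<forall>\<^sub>F d in sequentially. (real d)\<^sup>2 * exp ((1 - \<rho>) / 2 - 4 * \<kappa> * d) < \<eta> / 4"
  proof -
    have "((\<lambda>d::nat. (real d)\<^sup>2 * exp ((1 - \<rho>) / 2 - 4 * \<kappa> * d)) \<longlongrightarrow> 0) sequentially"
      using \<kappa> by real_asymp
    then show ?thesis using assms by (intro order_tendstoD) auto
  qed
  moreover have "\<forall>\<^sub>F d in sequentially. (real d)\<^sup>2 * (1 / real d ^ 3 + 4 * ln d / (real d ^ 3 * (ln d)\<^sup>2)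
      + ln 2 / ((real d)\<^sup>2 * ln d) + 1 / (real d ^ 3 * (ln d)\<^sup>2)) < c"
  proof -
    have "((\<lambda>d::nat. (real d)\<^sup>2 * (1 / real d ^ 3 + 4 * ln d / (real d ^ 3 * (ln d)\<^sup>2)
        + ln 2 / ((real d)\<^sup>2 * ln d) + 1 / (real d ^ 3 * (ln d)\<^sup>2))) \<longlongrightarrow> 0) sequentially"
      by real_asymp
    then show ?thesis using c by (intro order_tendstoD) auto
  qed
  moreover have "\<forall>\<^sub>F d in sequentially. exp (- (c * 2 ^ d / (real d)\<^sup>2)) < \<eta> / 4"
  proof -
    have "((\<lambda>d::nat. exp (- (c * 2 ^ d / (real d)\<^sup>2))) \<longlongrightarrow> 0) sequentially"
      using c by real_asymp
    then show ?thesis using assms by (intro order_tendstoD) auto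
  qed
  ultimately show ?thesis
  proof eventually_elim
    case (elim d)
    define n m where "n = (2::real) ^ d" and "m = 2 ^ d / (real d ^ 3 * (ln d)\<^sup>2)"
    \<comment> \<open>With \<open>l\<close> about sqrt d, \<open>2 ^ l\<close> exceeds
      \<open>K\<close> while l/d vanishes. With \<open>K\<close> about d^2 ln d, n/K is of lower
      order than n/d^2, while d m K/h times d is still only of order n/ln d.\<close>
    define g h l K where "g = nat \<lfloor>\<gamma> * d\<rfloor>" and "h = nat \<lfloor>\<kappa> * d\<rfloor>" and "l = nat \<lfloor>sqrt d\<rfloor>"
      and "K = nat \<lceil>(real d)\<^sup>2 * ln d\<rceil>"
    \<comment> \<open>This solves \<open>1 - p = (1 - p1) * (1 - p2)\<close> for total density
      \<open>(1 + \<epsilon>) / d\<close> and first-round density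
      \<open>(1 + x) / d\<close>.\<close>
    define p2 where "p2 = \<delta> / (d - 1 - x)"
    have n: "0 < n" by (simp add: n_def)
    have d: "2 * (1 + \<epsilon>) + 4 \<le> real d" by (rule elim(1))
    then have d4: "4 < real d" using assms by simp
    have lnd: "1 \<le> ln (real d)"
    proof -
      have "exp 1 \<le> real d" using exp_le d4 by linarith
      then show ?thesis using d4 by (subst ln_ge_iff) auto
    qed
    have m: "0 < m" using d4 lnd by (simp add: m_def)
    have dd: "0 < (real d)\<^sup>2 * ln d" using d4 lnd by simp
    have Kb: "(real d)\<^sup>2 * ln d \<le> K" "K \<le> (real d)\<^sup>2 * ln d + 1"
      unfolding K_def using nat_ceiling_bounds[of "(real d)\<^sup>2 * ln d"] dd by simp_all
    have "0 < real K" using Kb(1) dd by linarith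
    then have K0: "0 < K" by simp
    have gb: "\<gamma> * d - 1 \<le> g" "g \<le> \<gamma> * d"
      unfolding g_def using nat_floor_bounds[of "\<gamma> * d"] \<gamma> by simp_all
    have hb: "\<kappa> * d / 2 \<le> h" "h \<le> \<kappa> * d"
      unfolding h_def using nat_floor_bounds[of "\<kappa> * d"] elim(5) by linarith+
    have "0 < real h" using hb(1) elim(5) by linarith
    then have h0: "0 < h" by simp
    have lb: "sqrt d - 1 \<le> l" "l \<le> sqrt d"
      unfolding l_def using nat_floor_bounds[of "sqrt d"] by simp_all
    have "\<gamma> * d \<le> d / 2" using \<gamma>(2) mult_right_mono[of \<gamma> "1/2" d] by simp
    then have gd: "real g \<le> d / 2" using gb by linarith
    then have g_le: "g \<le> d" by linarith
    have "real l + real g \<le> d" using gd lb elim(3) by linarith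
    then have l_le: "l \<le> d - g" by linarith
    have "x / d * (d - g - l) \<ge> x - \<tau> / 2 - \<epsilon> / sqrt d"
    proof -
      have "x / d * g \<le> \<epsilon> / d * (\<gamma> * d)"
        using x gb d4 by (intro mult_mono divide_right_mono) auto
      also have "\<dots> = \<epsilon> * \<gamma>" using d4 by simp
      also have "\<dots> \<le> \<tau> / 2" by (rule \<gamma>(3))
      finally have 1: "x / d * g \<le> \<tau> / 2" .
      have "x / d * l \<le> \<epsilon> / d * sqrt d"
        using x lb d4 by (intro mult_mono divide_right_mono) auto
      also have "\<dots> = \<epsilon> / sqrt d" using d4 by (simp add: field_simps)
      finally have 2: "x / d * l \<le> \<epsilon> / sqrt d" .
      have "real (d - g - l) = real d - real g - real l" using g_le l_le by linarith
      then have "x / d * (d - g - l) = x - x / d * g - x / d * l"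
        using d4 by (simp add: right_diff_distrib)
      then show ?thesis using 1 2 by linarith
    qed
    moreover have "2 * l / d \<le> 2 / sqrt d"
    proof -
      have "2 * l / d \<le> 2 * sqrt d / d" using lb d4 by (intro divide_right_mono) auto
      also have "2 * sqrt d / d = 2 / sqrt d" using d4 by (simp add: field_simps)
      finally show ?thesis .
    qed
    moreover have "2 / sqrt d + \<epsilon> / sqrt d \<le> \<tau> / 2" using elim(4) by (simp add: add_divide_distrib)
    ultimately have "2 * l / d - x / d * (d - g - l) \<le> - x + \<tau>" by linarith
    then have "(1 + x) * exp (2 * l / d - x / d * (d - g - l)) \<le> (1 + x) * exp (- x + \<tau>)"
      using x by (intro mult_left_mono) auto
    also have "\<dots> = (1 + x) * exp (- x) * exp \<tau>" by (simp only: exp_add mult.assoc)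
    also have "\<dots> \<le> \<rho>0 * exp \<tau>" by (intro mult_right_mono x_exp) simp
    finally have \<rho>_bound: "(1 + x) * exp (2 * l / d - x / d * (d - g - l)) \<le> \<rho>" using \<tau>(2) by simp
    have K_le: "K \<le> 2 ^ l"
    proof -
      have "real K \<le> 2 powr (sqrt d - 1)" using Kb elim(2) by linarith
      also have "\<dots> \<le> 2 powr l" using lb by (intro powr_mono) auto
      also have "\<dots> = real (2 ^ l)" by (simp add: powr_realpow)
      finally show ?thesis by (simp only: of_nat_le_iff)
    qed
    have dx: "d / 2 \<le> d - 1 - x" "0 < d - 1 - x" using d x by auto
    have p2: "\<delta> / d \<le> p2" "p2 * d \<le> 2 * \<delta>" "0 \<le> p2" "p2 \<le> 1"
    proof -
      show "\<delta> / d \<le> p2" unfolding p2_def using \<delta> dx x d4 by (intro divide_left_mono) auto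
      have "p2 \<le> \<delta> / (d / 2)" unfolding p2_def using \<delta> dx d4 by (intro divide_left_mono) auto
      then show "p2 * d \<le> 2 * \<delta>" using d4 by (simp add: field_simps)
      show "0 \<le> p2" using \<delta> dx by (simp add: p2_def)
      show "p2 \<le> 1" using \<delta> dx d x by (simp add: p2_def)
    qed
    have p: "1 - (1 + \<epsilon>) / d = (1 - (1 + x) / d) * (1 - p2)"
    proof -
      have "1 - (1 + x) / d = (d - 1 - x) / d" using d4 by (simp add: field_simps)
      then have "(1 - (1 + x) / d) * p2 = \<delta> / d" unfolding p2_def using dx by simp
      then show ?thesis by (simp add: right_diff_distrib x_def add_divide_distrib diff_divide_distrib)
    qed
    have mK: "2 * m * K \<le> \<alpha> * n / 2 / 2"
    proof -
      have "2 * m * K \<le> 2 * m * ((real d)\<^sup>2 * ln d + 1)" using Kb m by (intro mult_left_mono) auto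
      also have "\<dots> = n * (2 * ((real d)\<^sup>2 * ln d + 1) / (real d ^ 3 * (ln d)\<^sup>2))"
        by (simp add: m_def n_def)
      also have "\<dots> \<le> n * (\<alpha> / 4)" using elim(7) n by (intro mult_left_mono) auto
      finally show ?thesis by (simp add: mult.commute)
    qed
    have good: "d * (n / (real d)\<^sup>2 + d * m * K / h) \<le> \<alpha> * n / 2 / 2"
    proof -
      have "d * m * K / h \<le> d * m * ((real d)\<^sup>2 * ln d + 1) / (\<kappa> * d / 2)"
        using Kb hb m \<kappa> d4 dd by (intro frac_le mult_left_mono) auto
      then have "d * (n / (real d)\<^sup>2 + d * m * K / h)
        \<le> d * (n / (real d)\<^sup>2 + d * m * ((real d)\<^sup>2 * ln d + 1) / (\<kappa> * d / 2))"
        by (intro mult_left_mono add_left_mono) auto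
      also have "\<dots> = n * (real d * (1 / (real d)\<^sup>2
          + real d / (real d ^ 3 * (ln d)\<^sup>2) * ((real d)\<^sup>2 * ln d + 1) / (\<kappa> * d / 2)))"
        by (simp add: m_def n_def distrib_left mult_ac)
      also have "\<dots> \<le> n * (\<alpha> / 4)" using elim(8) n by (intro mult_left_mono) auto
      finally show ?thesis by (simp add: mult.commute)
    qed
    \<comment> \<open>Instances: the lower size bound on each part is
      \<open>\<alpha> * n / 2\<close>, the tolerated number of vertices with few big neighbours is
      n/d^2, and the weight in the count of boundaries is d^-4, whose cost is n/d^3.\<close>
    have "bprob (cube_edges d) ((1 + \<epsilon>) / d) (sparse_cut d (2 * (\<alpha> * n / 2)) m)
      \<le> 2 ^ d * exp (4 * h - (1 - \<rho>) * g / 2) / (n / (real d)\<^sup>2)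
      + 2 ^ d * (\<rho> ^ k + k * d * p2) / (\<alpha> * n / 2 / 2)
      + exp (1 / real d ^ 4 * (2 ^ d * d) - m * ln (1 / real d ^ 4) + ln 2 * 2 ^ d / K + m
          - p2 * (1 - (1 - p2) ^ h)\<^sup>2 * (\<alpha> * n / 2) / (4 * d))"
      (is "_ \<le> ?T1 + ?T2 + exp ?X")
    proof (rule bprob_sparse_cut_sprinkled[OF _ _ _ l_le g_le \<rho>_bound _ K_le K0 refl p p2(3,4) _ _ h0])
      show "real k \<le> 2 * (\<alpha> * n / 2)" using elim(6) by (simp add: n_def)
    qed (use d d4 x \<rho> assms n m mK good in auto)
    moreover have "?T1 \<le> \<eta> / 4"
    proof -
      have "4 * h - (1 - \<rho>) * g / 2 \<le> 4 * (\<kappa> * d) - (1 - \<rho>) * (\<gamma> * d - 1) / 2"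
        using hb gb \<rho> by (intro diff_mono divide_right_mono mult_left_mono) auto
      also have "\<dots> = (1 - \<rho>) / 2 - 4 * \<kappa> * d"
        by (simp add: \<kappa>_def field_simps)
      finally have "exp (4 * h - (1 - \<rho>) * g / 2) \<le> exp ((1 - \<rho>) / 2 - 4 * \<kappa> * d)" by simp
      then have "(real d)\<^sup>2 * exp (4 * h - (1 - \<rho>) * g / 2)
        \<le> (real d)\<^sup>2 * exp ((1 - \<rho>) / 2 - 4 * \<kappa> * d)" by (intro mult_left_mono) auto
      then show ?thesis using elim(9) by (simp add: n_def mult.commute)
    qed
    moreover have "?T2 \<le> \<eta> / 2"
    proof -
      have "k * d * p2 \<le> 2 * k * \<delta>"
        using mult_left_mono[OF p2(2), of k] by (simp add: mult_ac)
      then have "\<rho> ^ k + k * d * p2 \<le> \<alpha> * \<eta> / 8" using k \<delta>(3) by linarith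
      then have "(\<rho> ^ k + k * d * p2) * (4 / \<alpha>) \<le> \<alpha> * \<eta> / 8 * (4 / \<alpha>)"
        using assms by (intro mult_right_mono) auto
      then show ?thesis using assms by (simp add: n_def mult_ac)
    qed
    moreover have "exp ?X \<le> \<eta> / 4"
    proof -
      have "(1 - p2) ^ h \<le> exp (- p2) ^ h"
        using p2 exp_ge_add_one_self[of "- p2"] by (intro power_mono) auto
      also have "\<dots> = exp (- (p2 * h))" by (simp add: mult.commute flip: exp_of_nat_mult)
      also have "\<dots> \<le> exp (- (\<delta> / d * (\<kappa> * d / 2)))"
        using mult_mono[OF p2(1) hb(1)] p2 \<kappa> d4 by simp
      also have "\<delta> / d * (\<kappa> * d / 2) = \<delta> * \<kappa> / 2" using d4 by simp
      finally have "s0 \<le> 1 - (1 - p2) ^ h" by (simp add: s0_def)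
      then have "s0\<^sup>2 \<le> (1 - (1 - p2) ^ h)\<^sup>2" using s0 by (intro power_mono) auto
      then have "\<delta> / d * s0\<^sup>2 \<le> p2 * (1 - (1 - p2) ^ h)\<^sup>2" using p2 s0 by (intro mult_mono) auto
      then have "\<delta> / d * s0\<^sup>2 * (\<alpha> * n / 2) / (4 * d)
        \<le> p2 * (1 - (1 - p2) ^ h)\<^sup>2 * (\<alpha> * n / 2) / (4 * d)"
        using assms n d4 by (intro divide_right_mono mult_right_mono) auto
      moreover have "\<delta> / d * s0\<^sup>2 * (\<alpha> * n / 2) / (4 * d) = 2 * (c * n / (real d)\<^sup>2)"
        using d4 by (simp add: c_def power2_eq_square)
      moreover have "ln 2 * 2 ^ d / K \<le> ln 2 * n / ((real d)\<^sup>2 * ln d)"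
        unfolding n_def using Kb dd by (intro frac_le) auto
      moreover have "ln (1 / real d ^ 4) = - (4 * ln d)" using d4 by (simp add: ln_div ln_realpow)
      moreover have "1 / real d ^ 4 * (2 ^ d * d) = n * (1 / real d ^ 3)"
        using d4 by (simp add: n_def power_numeral_reduce)
      \<comment> \<open>The positive terms are, in order, the cost of choosing \<open>M\<close> (two
        terms), the choice of big components, and the allowance \<open>m\<close> from the Chernoff
        bound. Together they stay below \<open>c * n / (real d)\<^sup>2\<close>, half of the
        negative term.\<close>
      ultimately have "?X \<le> n * (1 / real d ^ 3) + m * (4 * ln d) + ln 2 * n / ((real d)\<^sup>2 * ln d) + m
        - 2 * (c * n / (real d)\<^sup>2)" by simp
      also have "\<dots> = n / (real d)\<^sup>2 * ((real d)\<^sup>2 * (1 / real d ^ 3 + 4 * ln d / (real d ^ 3 * (ln d)\<^sup>2)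
        + ln 2 / ((real d)\<^sup>2 * ln d) + 1 / (real d ^ 3 * (ln d)\<^sup>2))) - 2 * (c * n / (real d)\<^sup>2)"
        using d4 unfolding m_def n_def[symmetric] by (simp add: distrib_left mult_ac)
      also have "\<dots> \<le> n / (real d)\<^sup>2 * c - 2 * (c * n / (real d)\<^sup>2)"
        using elim(10) n by (intro diff_right_mono mult_left_mono) auto
      also have "\<dots> = - (c * 2 ^ d / (real d)\<^sup>2)" by (simp add: n_def)
      finally have "exp ?X \<le> exp (- (c * 2 ^ d / (real d)\<^sup>2))" by simp
      then show ?thesis using elim(11) by linarith
    qed
    ultimately have "bprob (cube_edges d) ((1 + \<epsilon>) / d) (sparse_cut d (2 * (\<alpha> * n / 2)) m) \<le> \<eta>"
      by linarith
    then show ?case by (simp add: n_def m_def)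
  qed
qed

theorem theorem1p4:
  shows "\<forall>\<epsilon>::real. \<epsilon> > 0 \<longrightarrow> (\<exists>\<alpha>\<^sub>0::real. \<alpha>\<^sub>0 > 0 \<and>
    (\<forall>\<alpha>::real. 0 < \<alpha> \<and> \<alpha> \<le> \<alpha>\<^sub>0 \<longrightarrow> (\<exists>\<beta>::real. \<beta> > 0 \<and>
      ((\<lambda>d::nat. cube_prob d ((1 + \<epsilon>) / real d)
          (\<lambda>F. \<forall>L. largest_component d F L \<longrightarrow>
             (\<forall>S. S \<subseteq> L \<and> \<alpha> * 2 ^ d \<le> real (card S) \<and> real (card S) \<le> real (card L) / 2 \<longrightarrow>
                real (card (edge_boundary F S)) \<ge> \<beta> * 2 ^ d / (real d ^ 3 * (ln (real d))\<^sup>2))))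
        \<longlonglongrightarrow> 1))))"
proof (intro allI impI)
  fix \<epsilon> :: real assume \<epsilon>: "0 < \<epsilon>"
  have "(\<lambda>d::nat. cube_prob d ((1 + \<epsilon>) / real d)
      (\<lambda>F. \<forall>L. largest_component d F L \<longrightarrow>
        (\<forall>S. S \<subseteq> L \<and> \<alpha> * 2 ^ d \<le> real (card S) \<and> real (card S) \<le> real (card L) / 2 \<longrightarrow>
          real (card (edge_boundary F S)) \<ge> 1 * 2 ^ d / (real d ^ 3 * (ln (real d))\<^sup>2))))
      \<longlonglongrightarrow> 1" (is "(\<lambda>d. cube_prob d (?p d) (?P d)) \<longlonglongrightarrow> 1") if \<alpha>: "0 < \<alpha>" for \<alpha>
  proof (rule LIMSEQ_I)
    fix r :: real assume r: "0 < r"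
    let ?S = "\<lambda>d. sparse_cut d (\<alpha> * 2 ^ d) (2 ^ d / (real d ^ 3 * (ln d)\<^sup>2))"
    have "\<forall>\<^sub>F d in sequentially. bprob (cube_edges d) (?p d) (?S d) \<le> r / 2"
      using \<epsilon> \<alpha> r by (intro eventually_sparse_cut_unlikely) auto
    moreover have "\<forall>\<^sub>F d in sequentially. 1 + \<epsilon> \<le> real d" by real_asymp
    ultimately have "\<forall>\<^sub>F d in sequentially. norm (cube_prob d (?p d) (?P d) - 1) < r"
    proof eventually_elim
      case (elim d)
      have p: "0 \<le> ?p d" "?p d \<le> 1" using elim(2) \<epsilon> by auto
      have eq: "cube_prob d (?p d) (?P d) = bprob (cube_edges d) (?p d) (?P d)"
        unfolding cube_prob_def bexp_def by (intro sum.cong) auto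
      have "1 - bprob (cube_edges d) (?p d) (?S d) = bprob (cube_edges d) (?p d) (\<lambda>F. \<not> ?S d F)"
        by (simp only: bprob_not[OF finite_cube_edges])
      also have "\<dots> \<le> bprob (cube_edges d) (?p d) (?P d)"
      proof (intro bprob_mono p)
        fix F assume "\<not> ?S d F"
        then show "?P d F"
          \<comment> \<open>The absence of sparse cuts holds in all components, hence in every
            largest one, ties included.\<close>
          unfolding sparse_cut_def largest_component_def mult_1 by (meson not_le)
      qed
      finally have "1 - r / 2 \<le> cube_prob d (?p d) (?P d)" using elim(1) eq by linarith
      moreover have "cube_prob d (?p d) (?P d) \<le> 1"
        unfolding eq by (intro bprob_le_1 p) simp
      ultimately show ?case using r by simp
    qed
    then show "\<exists>N. \<forall>d\<ge>N. norm (cube_prob d (?p d) (?P d) - 1) < r"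
      by (simp add: eventually_sequentially)
  qed
  then show "\<exists>\<alpha>\<^sub>0::real. \<alpha>\<^sub>0 > 0 \<and>
    (\<forall>\<alpha>::real. 0 < \<alpha> \<and> \<alpha> \<le> \<alpha>\<^sub>0 \<longrightarrow> (\<exists>\<beta>::real. \<beta> > 0 \<and>
      ((\<lambda>d::nat. cube_prob d ((1 + \<epsilon>) / real d)
          (\<lambda>F. \<forall>L. largest_component d F L \<longrightarrow>
             (\<forall>S. S \<subseteq> L \<and> \<alpha> * 2 ^ d \<le> real (card S) \<and> real (card S) \<le> real (card L) / 2 \<longrightarrow>
                real (card (edge_boundary F S)) \<ge> \<beta> * 2 ^ d / (real d ^ 3 * (ln (real d))\<^sup>2))))
        \<longlonglongrightarrow> 1)))"
    \<comment> \<open>The value 1 is the witness for both \<open>\<alpha>\<^sub>0\<close> and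
      \<beta>; the limit above was shown for every positive \<alpha>.\<close>
    by (intro exI[of _ 1] conjI allI impI) auto
qed

end
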